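(* Let $(H,p,D,U)$ be an oriented quantum algebra over a field $K$, and write $p=p_i\otimes p^i=p_j\otimes p^j=p_k\otimes p^k$ and $p^{-1}=P=P_l\otimes P^l$. Then $(H\otimes H,\tilde\alpha,\tilde D,\tilde U)$ is an oriented quantum algebra, where $$\tilde\alpha=p_ip_j\otimes p_kP^l\otimes p^jP_l\otimes p^ip^k\in(H\otimes H)\otimes(H\otimes H),\qquad \tilde D=D\otimes D,\qquad \tilde U=U\otimes U.$$
   Context: All algebras are associative unital algebras over a field $K$; $\otimes=\otimes_K$. Summation convention: an element $r=\sum r_i\otimes r^i$ of a tensor product is written formally as a single tensor $r=r_i\otimes r^i=r_j\otimes r^j=\cdots$, different indices denoting independent copies of the sum. When several tensors occur in an expression, summation over all of the indices is understood. Oriented quantum algebra (OQA): a quadruple $(H,r,D,U)$ where $H$ is an algebra, $r=r_i\otimes r^i\in H\otimes H$ is invertible with inverse $r^{-1}=R_l\otimes R^l$, and $D,U$ are commuting algebra automorphisms of $H$, such that (1) $(D\otimes \mathrm{id}_H)(r^{-1})$ and $(\mathrm{id}_H\otimes U)(r)$ are inverse to each other in $H\otimes H^{op}$, i.e. $D(R_l)r_i\otimes U(r^i)R^l=1\otimes1=r_iD(R_l)\otimes R^lU(r^i)$; (2) $(D\otimes D)(r)=r=(U\otimes U)(r)$; (3) $r_{12}r_{13}r_{23}=r_{23}r_{13}r_{12}$ in $H\otimes H\otimes H$, i.e. $r_ir_j\otimes r^ir_k\otimes r^jr^k=r_jr_i\otimes r_kr^i\otimes r^kr^j$. *)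

theory Defs
  imports "HOL-Algebra.Module" "HOL-Algebra.QuotRing" "HOL-Algebra.Free_Abelian_Groups"
    "HOL-Algebra.Generated_Groups"
begin

section \<open>Associative unital algebras over a field\<close>

text \<open>The library locale \<^locale>\<open>algebra\<close> requires a commutative multiplication, hence this variant.\<close>

locale assoc_algebra = field K + module K A + alg: ring A for K (structure) and A (structure) +
  assumes smult_mult_left:
      "\<lbrakk>k \<in> carrier K; x \<in> carrier A; y \<in> carrier A\<rbrakk>
        \<Longrightarrow> (k \<odot>\<^bsub>A\<^esub> x) \<otimes>\<^bsub>A\<^esub> y = k \<odot>\<^bsub>A\<^esub> (x \<otimes>\<^bsub>A\<^esub> y)"
    and smult_mult_right:
      "\<lbrakk>k \<in> carrier K; x \<in> carrier A; y \<in> carrier A\<rbrakk>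
        \<Longrightarrow> x \<otimes>\<^bsub>A\<^esub> (k \<odot>\<^bsub>A\<^esub> y) = k \<odot>\<^bsub>A\<^esub> (x \<otimes>\<^bsub>A\<^esub> y)"

definition algebra_auto :: "('k, 'm) ring_scheme \<Rightarrow> ('k, 'a, 'n) module_scheme \<Rightarrow> ('a \<Rightarrow> 'a) set" where
  "algebra_auto K A =
    {f \<in> ring_iso A A. \<forall>k \<in> carrier K. \<forall>x \<in> carrier A. f (k \<odot>\<^bsub>A\<^esub> x) = k \<odot>\<^bsub>A\<^esub> f x}"

definition op_algebra :: "('k, 'a, 'n) module_scheme \<Rightarrow> ('k, 'a, 'n) module_scheme" where
  "op_algebra A = A\<lparr>monoid.mult := \<lambda>x y. y \<otimes>\<^bsub>A\<^esub> x\<rparr>"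


section \<open>Tensor products over \<open>K\<close>\<close>

text \<open>
  The tensor product of \<open>A\<close> and \<open>B\<close> over \<open>K\<close> is the free abelian group on
  \<open>carrier A \<times> carrier B\<close> modulo the subgroup generated by the relators of a biadditive
  \<open>K\<close>-balanced map; its elements are therefore cosets of formal integer combinations of pairs.
  The group operations of \<open>free_Abelian_group\<close> are written multiplicatively in the library.
\<close>

definition tensor_relators ::
    "('k, 'm) ring_scheme \<Rightarrow> ('k, 'a, 'n) module_scheme \<Rightarrow> ('k, 'b, 'o) module_scheme
      \<Rightarrow> ('a \<times> 'b \<Rightarrow>\<^sub>0 int) set" where
  "tensor_relators K A B =
      {frag_of (a \<oplus>\<^bsub>A\<^esub> a', b) - frag_of (a, b) - frag_of (a', b) | a a' b.
         a \<in> carrier A \<and> a' \<in> carrier A \<and> b \<in> carrier B}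
    \<union> {frag_of (a, b \<oplus>\<^bsub>B\<^esub> b') - frag_of (a, b) - frag_of (a, b') | a b b'.
         a \<in> carrier A \<and> b \<in> carrier B \<and> b' \<in> carrier B}
    \<union> {frag_of (k \<odot>\<^bsub>A\<^esub> a, b) - frag_of (a, k \<odot>\<^bsub>B\<^esub> b) | k a b.
         k \<in> carrier K \<and> a \<in> carrier A \<and> b \<in> carrier B}"

definition tensor_subgroup ::
    "('k, 'm) ring_scheme \<Rightarrow> ('k, 'a, 'n) module_scheme \<Rightarrow> ('k, 'b, 'o) module_scheme
      \<Rightarrow> ('a \<times> 'b \<Rightarrow>\<^sub>0 int) set" where
  "tensor_subgroup K A B =
    generate (free_Abelian_group (carrier A \<times> carrier B)) (tensor_relators K A B)"

definition tensor_group ::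
    "('k, 'm) ring_scheme \<Rightarrow> ('k, 'a, 'n) module_scheme \<Rightarrow> ('k, 'b, 'o) module_scheme
      \<Rightarrow> ('a \<times> 'b \<Rightarrow>\<^sub>0 int) set monoid" where
  "tensor_group K A B =
    free_Abelian_group (carrier A \<times> carrier B) Mod tensor_subgroup K A B"

definition pure_tensor ::
    "('k, 'm) ring_scheme \<Rightarrow> ('k, 'a, 'n) module_scheme \<Rightarrow> ('k, 'b, 'o) module_scheme
      \<Rightarrow> 'a \<Rightarrow> 'b \<Rightarrow> ('a \<times> 'b \<Rightarrow>\<^sub>0 int) set" where
  "pure_tensor K A B a b =
    tensor_subgroup K A B #>\<^bsub>free_Abelian_group (carrier A \<times> carrier B)\<^esub> frag_of (a, b)"

text \<open>
  The summation convention: if \<open>t\<close> is written as the formal sum of \<open>t\<^sub>i \<otimes> t\<^sup>i\<close>, then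
  \<open>tensor_sum G f t\<close> is the sum of the \<open>f t\<^sub>i t\<^sup>i\<close>, i.e. the value at \<open>t\<close> of the
  homomorphism induced by \<open>f\<close>. The target \<open>G\<close> is an abelian group in the library's multiplicative
  notation, so products and powers in \<open>G\<close> stand for sums and integer multiples. An arbitrary
  representative of the coset \<open>t\<close> is used; for biadditive balanced \<open>f\<close> (the only case
  used below) the value does not depend on it.
\<close>

definition tensor_sum ::
    "('c, 'm) monoid_scheme \<Rightarrow> ('a \<Rightarrow> 'b \<Rightarrow> 'c) \<Rightarrow> ('a \<times> 'b \<Rightarrow>\<^sub>0 int) set \<Rightarrow> 'c" where
  "tensor_sum G f t = (let F = SOME F. F \<in> t in
    finprod G (\<lambda>x. f (fst x) (snd x) [^]\<^bsub>G\<^esub> Poly_Mapping.lookup F x) (Poly_Mapping.keys F))"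

definition tensor_algebra ::
    "('k, 'm) ring_scheme \<Rightarrow> ('k, 'a, 'n) module_scheme \<Rightarrow> ('k, 'b, 'o) module_scheme
      \<Rightarrow> ('k, ('a \<times> 'b \<Rightarrow>\<^sub>0 int) set) module" where
  "tensor_algebra K A B =
    \<lparr>carrier = carrier (tensor_group K A B),
     monoid.mult = \<lambda>s t.
       tensor_sum (tensor_group K A B) (\<lambda>a b.
         tensor_sum (tensor_group K A B) (\<lambda>c d.
           pure_tensor K A B (a \<otimes>\<^bsub>A\<^esub> c) (b \<otimes>\<^bsub>B\<^esub> d)) t) s,
     one = pure_tensor K A B \<one>\<^bsub>A\<^esub> \<one>\<^bsub>B\<^esub>,
     ring.zero = \<one>\<^bsub>tensor_group K A B\<^esub>,
     ring.add = monoid.mult (tensor_group K A B),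
     smult = \<lambda>k. tensor_sum (tensor_group K A B) (\<lambda>a b. pure_tensor K A B (k \<odot>\<^bsub>A\<^esub> a) b)\<rparr>"

text \<open>\<open>f \<otimes> g\<close> as a map into the tensor product of \<open>C\<close> and \<open>D\<close>.\<close>

definition tensor_map ::
    "('k, 'm) ring_scheme \<Rightarrow> ('k, 'c, 'n) module_scheme \<Rightarrow> ('k, 'd, 'o) module_scheme
      \<Rightarrow> ('a \<Rightarrow> 'c) \<Rightarrow> ('b \<Rightarrow> 'd) \<Rightarrow> ('a \<times> 'b \<Rightarrow>\<^sub>0 int) set \<Rightarrow> ('c \<times> 'd \<Rightarrow>\<^sub>0 int) set" where
  "tensor_map K C D f g =
    tensor_sum (tensor_group K C D) (\<lambda>a b. pure_tensor K C D (f a) (g b))"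


section \<open>Oriented quantum algebras\<close>

text \<open>The threefold tensor product is bracketed as \<open>(H \<otimes> H) \<otimes> H\<close>.\<close>

definition tensor_cube ::
    "('k, 'm) ring_scheme \<Rightarrow> ('k, 'a, 'n) module_scheme
      \<Rightarrow> ('k, (('a \<times> 'a \<Rightarrow>\<^sub>0 int) set \<times> 'a \<Rightarrow>\<^sub>0 int) set) module" where
  "tensor_cube K H = tensor_algebra K (tensor_algebra K H H) H"

definition triple_tensor ::
    "('k, 'm) ring_scheme \<Rightarrow> ('k, 'a, 'n) module_scheme \<Rightarrow> 'a \<Rightarrow> 'a \<Rightarrow> 'a
      \<Rightarrow> (('a \<times> 'a \<Rightarrow>\<^sub>0 int) set \<times> 'a \<Rightarrow>\<^sub>0 int) set" where
  "triple_tensor K H a b c =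
    pure_tensor K (tensor_algebra K H H) H (pure_tensor K H H a b) c"

definition leg12 ::
    "('k, 'm) ring_scheme \<Rightarrow> ('k, 'a, 'n) module_scheme \<Rightarrow> ('a \<times> 'a \<Rightarrow>\<^sub>0 int) set
      \<Rightarrow> (('a \<times> 'a \<Rightarrow>\<^sub>0 int) set \<times> 'a \<Rightarrow>\<^sub>0 int) set" where
  "leg12 K H = tensor_sum (tensor_group K (tensor_algebra K H H) H) (\<lambda>a b. triple_tensor K H a b \<one>\<^bsub>H\<^esub>)"

definition leg13 ::
    "('k, 'm) ring_scheme \<Rightarrow> ('k, 'a, 'n) module_scheme \<Rightarrow> ('a \<times> 'a \<Rightarrow>\<^sub>0 int) set
      \<Rightarrow> (('a \<times> 'a \<Rightarrow>\<^sub>0 int) set \<times> 'a \<Rightarrow>\<^sub>0 int) set" where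
  "leg13 K H = tensor_sum (tensor_group K (tensor_algebra K H H) H) (\<lambda>a b. triple_tensor K H a \<one>\<^bsub>H\<^esub> b)"

definition leg23 ::
    "('k, 'm) ring_scheme \<Rightarrow> ('k, 'a, 'n) module_scheme \<Rightarrow> ('a \<times> 'a \<Rightarrow>\<^sub>0 int) set
      \<Rightarrow> (('a \<times> 'a \<Rightarrow>\<^sub>0 int) set \<times> 'a \<Rightarrow>\<^sub>0 int) set" where
  "leg23 K H = tensor_sum (tensor_group K (tensor_algebra K H H) H) (\<lambda>a b. triple_tensor K H \<one>\<^bsub>H\<^esub> a b)"

text \<open>
  In \<open>qa1\<close> the two factors lie in \<open>H \<otimes> H\<close>, which has the same underlying \<open>K\<close>-module as
  \<open>H \<otimes> op H\<close>; only the multiplication and unit are those of \<open>H \<otimes> op H\<close>.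
\<close>

locale oriented_quantum_algebra = assoc_algebra K H for K (structure) and H (structure) +
  fixes r :: "('b \<times> 'b \<Rightarrow>\<^sub>0 int) set" and D U :: "'b \<Rightarrow> 'b"
  assumes r_unit: "r \<in> Units (tensor_algebra K H H)"
    and D_auto: "D \<in> algebra_auto K H"
    and U_auto: "U \<in> algebra_auto K H"
    and D_U_commute: "x \<in> carrier H \<Longrightarrow> D (U x) = U (D x)"
    and qa1:
      "tensor_map K H (op_algebra H) D id (inv\<^bsub>tensor_algebra K H H\<^esub> r)
         \<otimes>\<^bsub>tensor_algebra K H (op_algebra H)\<^esub> tensor_map K H (op_algebra H) id U r
       = \<one>\<^bsub>tensor_algebra K H (op_algebra H)\<^esub>"
      "tensor_map K H (op_algebra H) id U r
         \<otimes>\<^bsub>tensor_algebra K H (op_algebra H)\<^esub>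
           tensor_map K H (op_algebra H) D id (inv\<^bsub>tensor_algebra K H H\<^esub> r)
       = \<one>\<^bsub>tensor_algebra K H (op_algebra H)\<^esub>"
    and qa2: "tensor_map K H H D D r = r" "tensor_map K H H U U r = r"
    and qa3:
      "leg12 K H r \<otimes>\<^bsub>tensor_cube K H\<^esub> leg13 K H r \<otimes>\<^bsub>tensor_cube K H\<^esub> leg23 K H r
       = leg23 K H r \<otimes>\<^bsub>tensor_cube K H\<^esub> leg13 K H r \<otimes>\<^bsub>tensor_cube K H\<^esub> leg12 K H r"


section \<open>The tensor product of an oriented quantum algebra with itself\<close>

text \<open>
  A prime marks the second tensor factor: \<open>p\<^sub>i'\<close> is \<open>p\<^sup>i\<close> and \<open>P\<^sub>l'\<close> is \<open>P\<^sup>l\<close>, where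
  \<open>P\<close> is the inverse of \<open>p\<close>. The result is the sum of
  \<open>p\<^sub>i p\<^sub>j \<otimes> p\<^sub>k P\<^sup>l \<otimes> p\<^sup>j P\<^sub>l \<otimes> p\<^sup>i p\<^sup>k\<close>, read in \<open>(H \<otimes> H) \<otimes> (H \<otimes> H)\<close>.
\<close>

definition alpha_tensor ::
    "('k, 'm) ring_scheme \<Rightarrow> ('k, 'a, 'n) module_scheme \<Rightarrow> ('a \<times> 'a \<Rightarrow>\<^sub>0 int) set
      \<Rightarrow> (('a \<times> 'a \<Rightarrow>\<^sub>0 int) set \<times> ('a \<times> 'a \<Rightarrow>\<^sub>0 int) set \<Rightarrow>\<^sub>0 int) set" where
  "alpha_tensor K H p =
    (let HH = tensor_algebra K H H;
         G = tensor_group K HH HH;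
         P = inv\<^bsub>HH\<^esub> p
     in tensor_sum G (\<lambda>p\<^sub>i p\<^sub>i'. tensor_sum G (\<lambda>p\<^sub>j p\<^sub>j'. tensor_sum G (\<lambda>p\<^sub>k p\<^sub>k'. tensor_sum G (\<lambda>P\<^sub>l P\<^sub>l'.
          pure_tensor K HH HH
            (pure_tensor K H H (p\<^sub>i \<otimes>\<^bsub>H\<^esub> p\<^sub>j) (p\<^sub>k \<otimes>\<^bsub>H\<^esub> P\<^sub>l'))
            (pure_tensor K H H (p\<^sub>j' \<otimes>\<^bsub>H\<^esub> P\<^sub>l) (p\<^sub>i' \<otimes>\<^bsub>H\<^esub> p\<^sub>k'))) P) p) p) p)"

end

theory Submission
  imports Defs
begin

text \<open>
  Number the tensor factors of \<open>(H \<otimes> H) \<otimes> (H \<otimes> H)\<close> by 1 to 4 and write \<open>p\<^sub>i\<^sub>j\<close> for \<open>p\<close>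
  placed in the factors \<open>i\<close> and \<open>j\<close>. Then \<open>\<alpha> = p\<^sub>1\<^sub>4 p\<^sub>1\<^sub>3 p\<^sub>2\<^sub>4 P\<^sub>3\<^sub>2\<close>: it is the cabling of a
  crossing in which the strands 1, 2 pass the strands 3, 4, with the crossing of 2 and 3 reversed.
  In the six-fold tensor power the strands can be ordered by height as \<open>1 > 3 > 5 > 2 > 4 > 6\<close>,
  with \<open>p\<close> at a crossing whose first strand is the higher one and the flipped inverse otherwise;
  hence every triple of strands satisfies a Yang-Baxter equation, and these combine to that of \<open>\<alpha>\<close>.
  For the first axiom, \<open>D \<otimes> id\<close> of \<open>\<alpha>\<^sup>-\<^sup>1\<close> and \<open>id \<otimes> U\<close> of \<open>\<alpha>\<close> become, in
  \<open>(H \<otimes> H) \<otimes> (H \<otimes> H)\<^sup>o\<^sup>p\<close>, products of four factors each which cancel pairwise by the axioms of \<open>p\<close>.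
\<close>

section \<open>Maps out of tensor products of modules\<close>

text \<open>Elements of a tensor product are cosets and \<open>tensor_sum\<close> evaluates a
  representative picked by choice, so no summation can be computed before its summand is known to
  come from a homomorphism. Everything is therefore phrased through
  \<open>tensor_lift B f g\<close>, the additive map sending a pure tensor of \<open>a\<close> and
  \<open>b\<close> to the product of \<open>f a\<close> and \<open>g b\<close>: if \<open>f\<close>
  and \<open>g\<close> embed \<open>H\<close> into slots i and j of \<open>B\<close>, its value at p
  is p_ij. The axioms of p are restated for an arbitrary target algebra by pushing the given
  identity along an algebra homomorphism; inverses, telescoping and cabling are then computations
  with words in a monoid. The obstacle is axiom (1) for \<alpha>: the maps into the product with the
  opposite algebra reverse the multiplication in slots 3 and 4 only, so the image of a product of
  four factors is a product of the images only after a reordering. One exists because the orders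
  prescribed in the four slots have a common linear extension. The factor with the flipped inverse
  has its first leg in a reversed slot, so it needs the mirrored form of axiom (1), which is where
  axiom (2) for p enters.\<close>

text \<open>The right-hand side has the shape of the sum in \<open>tensor_sum\<close>, so a sum over
  a chosen representative becomes a value of a homomorphism.\<close>

lemma hom_free_Abelian_group_eval:
  assumes "comm_group G" and h: "h \<in> hom (free_Abelian_group S) G" and F: "Poly_Mapping.keys F \<subseteq> S"
  shows "h F = finprod G (\<lambda>x. h (frag_of x) [^]\<^bsub>G\<^esub> Poly_Mapping.lookup F x) (Poly_Mapping.keys F)"
proof -
  interpret G: comm_group G by fact
  interpret h: group_hom "free_Abelian_group S" G h
    using h by (simp add: group_hom_def group_hom_axioms_def)
  have *: "finite J \<Longrightarrow> J \<subseteq> S \<Longrightarrow>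
     h (\<Sum>i\<in>J. frag_cmul (c i) (frag_of i)) = finprod G (\<lambda>x. h (frag_of x) [^]\<^bsub>G\<^esub> c x) J" for J c
  proof (induction J rule: finite_induct)
    case empty
    then show ?case using h.hom_one by simp
  next
    case (insert x J)
    have x: "frag_of x \<in> carrier (free_Abelian_group S)" using insert by simp
    have cl: "(\<Sum>i\<in>J. frag_cmul (c i) (frag_of i)) \<in> carrier (free_Abelian_group S)"
      by (rule sum_closed_free_Abelian_group)
        (use insert in \<open>auto simp: keys_cmul_iff dest!: subsetD[OF keys_cmul]\<close>)
    have cx: "frag_cmul (c x) (frag_of x) = frag_of x [^]\<^bsub>free_Abelian_group S\<^esub> c x"
      using insert by simp
    have "frag_cmul (c x) (frag_of x) \<in> carrier (free_Abelian_group S)"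
      unfolding cx by (rule group.int_pow_closed[OF group_free_Abelian_group x])
    from h.hom_mult[OF this cl]
    have "h (frag_cmul (c x) (frag_of x) + (\<Sum>i\<in>J. frag_cmul (c i) (frag_of i)))
       = h (frag_cmul (c x) (frag_of x)) \<otimes>\<^bsub>G\<^esub> h (\<Sum>i\<in>J. frag_cmul (c i) (frag_of i))"
      by simp
    also have "h (frag_cmul (c x) (frag_of x)) = h (frag_of x) [^]\<^bsub>G\<^esub> c x"
      unfolding cx by (rule h.hom_int_pow[OF x])
    finally show ?case
      using insert h.hom_closed[of "frag_of _"] by (subst G.finprod_insert) auto
  qed
  have "F = (\<Sum>i\<in>Poly_Mapping.keys F. frag_cmul (Poly_Mapping.lookup F i) (frag_of i))"
    using frag_expansion[of F]  by (simp add: frag_extend_def o_def)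
  with *[of "Poly_Mapping.keys F" "Poly_Mapping.lookup F"] F show ?thesis by simp
qed

definition balanced ::
    "('k, 'm) ring_scheme \<Rightarrow> ('k, 'a, 'n) module_scheme \<Rightarrow> ('k, 'b, 'o) module_scheme
      \<Rightarrow> ('c, 'l) monoid_scheme \<Rightarrow> ('a \<Rightarrow> 'b \<Rightarrow> 'c) \<Rightarrow> bool" where
  "balanced K A B G f \<longleftrightarrow>
    (\<forall>a\<in>carrier A. \<forall>b\<in>carrier B. f a b \<in> carrier G) \<and>
    (\<forall>a\<in>carrier A. \<forall>a'\<in>carrier A. \<forall>b\<in>carrier B. f (a \<oplus>\<^bsub>A\<^esub> a') b = f a b \<otimes>\<^bsub>G\<^esub> f a' b) \<and>
    (\<forall>a\<in>carrier A. \<forall>b\<in>carrier B. \<forall>b'\<in>carrier B. f a (b \<oplus>\<^bsub>B\<^esub> b') = f a b \<otimes>\<^bsub>G\<^esub> f a b') \<and>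
    (\<forall>k\<in>carrier K. \<forall>a\<in>carrier A. \<forall>b\<in>carrier B. f (k \<odot>\<^bsub>A\<^esub> a) b = f a (k \<odot>\<^bsub>B\<^esub> b))"

locale tensor_product = A: module K A + B: module K B
  for K (structure) and A B
begin

abbreviation "S \<equiv> carrier A \<times> carrier B"
abbreviation "N \<equiv> tensor_subgroup K A B"
abbreviation "T \<equiv> tensor_group K A B"
abbreviation pt where "pt \<equiv> pure_tensor K A B"

lemma relators_subset: "tensor_relators K A B \<subseteq> carrier (free_Abelian_group S)"
proof -
  have "frag_of x - frag_of y \<in> carrier (free_Abelian_group S)"
       "frag_of x - frag_of y - frag_of z \<in> carrier (free_Abelian_group S)"
    if "x \<in> S" "y \<in> S" "z \<in> S" for x y z
    using keys_diff[of "frag_of x" "frag_of y"] keys_diff[of "frag_of x - frag_of y" "frag_of z"] that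
    by auto
  then show ?thesis
    unfolding tensor_relators_def
    by (auto simp del: carrier_free_Abelian_group_iff)
qed

lemma subgroup_N: "subgroup N (free_Abelian_group S)"
  unfolding tensor_subgroup_def
  by (rule group.generate_is_subgroup[OF group_free_Abelian_group relators_subset])

lemma normal_N: "N \<lhd> free_Abelian_group S"
  using comm_group.normal_iff_subgroup[OF abelian_free_Abelian_group] subgroup_N by blast

lemma comm_group_tensor_group: "comm_group T"
  unfolding tensor_group_def
  by (rule comm_group.abelian_FactGroup[OF abelian_free_Abelian_group subgroup_N])

lemma coset_hom: "(\<lambda>u. N #>\<^bsub>free_Abelian_group S\<^esub> u) \<in> hom (free_Abelian_group S) T"
  unfolding tensor_group_def by (rule normal.r_coset_hom_Mod[OF normal_N])

lemma pure_closed: "a \<in> carrier A \<Longrightarrow> b \<in> carrier B \<Longrightarrow> pt a b \<in> carrier T"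
  unfolding pure_tensor_def by (rule hom_in_carrier[OF coset_hom]) simp

text \<open>This removes the choice from \<open>tensor_sum\<close>: whichever representative
  \<open>v\<close> of the coset is picked, \<open>h\<close> composed with the coset map is a
  homomorphism on the free group with the same value at \<open>v\<close>. Agreement of
  \<open>f\<close> with \<open>h\<close> on pure tensors is enough.\<close>

lemma tensor_sum_hom:
  assumes G: "comm_group G" and h: "h \<in> hom T G" and t: "t \<in> carrier T"
    and f: "\<And>a b. a \<in> carrier A \<Longrightarrow> b \<in> carrier B \<Longrightarrow> f a b = h (pt a b)"
  shows "tensor_sum G f t = h t"
proof -
  let ?c = "\<lambda>u. N #>\<^bsub>free_Abelian_group S\<^esub> u"
  interpret G: comm_group G by fact
  interpret F: group "free_Abelian_group S" by simp
  from t obtain u where u: "u \<in> carrier (free_Abelian_group S)" "t = ?c u"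
    by (auto simp: tensor_group_def carrier_FactGroup)
  then have "u \<in> t" using F.rcos_self[OF u(1) subgroup_N] by simp
  define v where "v = (SOME F. F \<in> t)"
  have v: "v \<in> t" unfolding v_def using \<open>u \<in> t\<close> by (rule someI)
  have v': "v \<in> carrier (free_Abelian_group S)"
    using v u F.r_coset_subset_G[OF subgroup.subset[OF subgroup_N]] by blast
  have tv: "t = ?c v"
    using F.repr_independence[OF _ _ subgroup_N] u v by simp
  have hom: "h \<circ> ?c \<in> hom (free_Abelian_group S) G"
    using coset_hom h by (rule Group.hom_compose)
  have "h t = (h \<circ> ?c) v" using tv by simp
  also have "\<dots> = finprod G (\<lambda>x. (h \<circ> ?c) (frag_of x) [^]\<^bsub>G\<^esub> Poly_Mapping.lookup v x) (Poly_Mapping.keys v)"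
    by (rule hom_free_Abelian_group_eval[OF G hom]) (use v' in simp)
  also have "\<dots> = finprod G (\<lambda>x. f (fst x) (snd x) [^]\<^bsub>G\<^esub> Poly_Mapping.lookup v x) (Poly_Mapping.keys v)"
  proof (rule G.finprod_cong')
    have "h (pt a b) \<in> carrier G" if "a \<in> carrier A" "b \<in> carrier B" for a b
      using hom_in_carrier[OF h pure_closed] that by auto
    then show "(\<lambda>x. f (fst x) (snd x) [^]\<^bsub>G\<^esub> Poly_Mapping.lookup v x) \<in> Poly_Mapping.keys v \<rightarrow> carrier G"
      using v' by (auto simp: f intro!: G.int_pow_closed dest!: subsetD)
    show "(h \<circ> ?c) (frag_of x) [^]\<^bsub>G\<^esub> Poly_Mapping.lookup v x = f (fst x) (snd x) [^]\<^bsub>G\<^esub> Poly_Mapping.lookup v x"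
      if "x \<in> Poly_Mapping.keys v" for x
      using that v' by (cases x) (auto simp: f pure_tensor_def dest!: subsetD)
  qed simp
  finally show ?thesis by (simp add: tensor_sum_def v_def Let_def)
qed

text \<open>Pure tensors generate, being the images of the free generators; the induction runs over
  the free group before passing to cosets.\<close>

lemma hom_ext:
  assumes G: "group G" and h: "h \<in> hom T G" "h' \<in> hom T G" and t: "t \<in> carrier T"
    and eq: "\<And>a b. a \<in> carrier A \<Longrightarrow> b \<in> carrier B \<Longrightarrow> h (pt a b) = h' (pt a b)"
  shows "h t = h' t"
proof -
  let ?c = "\<lambda>u. N #>\<^bsub>free_Abelian_group S\<^esub> u"
  interpret g: group_hom "free_Abelian_group S" G "h \<circ> ?c"
    using Group.hom_compose[OF coset_hom h(1)] G by (simp add: group_hom_def group_hom_axioms_def)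
  interpret g': group_hom "free_Abelian_group S" G "h' \<circ> ?c"
    using Group.hom_compose[OF coset_hom h(2)] G by (simp add: group_hom_def group_hom_axioms_def)
  from t obtain u where u: "Poly_Mapping.keys u \<subseteq> S" "t = ?c u"
    by (auto simp: tensor_group_def carrier_FactGroup)
  have "(h \<circ> ?c) u = (h' \<circ> ?c) u"
    using u(1)
  proof (rule free_Abelian_group_induct)
    show "(h \<circ> ?c) 0 = (h' \<circ> ?c) 0" using g.hom_one g'.hom_one by simp
    fix x y assume xy: "Poly_Mapping.keys x \<subseteq> S" "Poly_Mapping.keys y \<subseteq> S"
      "(h \<circ> ?c) x = (h' \<circ> ?c) x" "(h \<circ> ?c) y = (h' \<circ> ?c) y"
    have diff: "x \<otimes>\<^bsub>free_Abelian_group S\<^esub> inv\<^bsub>free_Abelian_group S\<^esub> y = x - y"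
      and y: "inv\<^bsub>free_Abelian_group S\<^esub> y \<in> carrier (free_Abelian_group S)"
      and x: "x \<in> carrier (free_Abelian_group S)" and y': "y \<in> carrier (free_Abelian_group S)"
      using xy by simp_all
    show "(h \<circ> ?c) (x - y) = (h' \<circ> ?c) (x - y)"
      unfolding diff[symmetric] g.hom_mult[OF x y] g'.hom_mult[OF x y] g.hom_inv[OF y'] g'.hom_inv[OF y']
      by (simp only: xy)
  next
    show "(h \<circ> ?c) (frag_of a) = (h' \<circ> ?c) (frag_of a)" if "a \<in> S" for a
      using that eq by (cases a) (auto simp: pure_tensor_def)
  qed
  then show ?thesis using u by simp
qed

lemma coset_eqI:
  assumes "x - y \<in> tensor_relators K A B" "Poly_Mapping.keys x \<subseteq> S" "Poly_Mapping.keys y \<subseteq> S"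
  shows "N #>\<^bsub>free_Abelian_group S\<^esub> x = N #>\<^bsub>free_Abelian_group S\<^esub> y"
proof -
  interpret F: group "free_Abelian_group S" by simp
  have "x - y \<in> N" unfolding tensor_subgroup_def using assms(1) by (rule generate.incl)
  then have "x \<in> N #>\<^bsub>free_Abelian_group S\<^esub> y"
    unfolding r_coset_def by (auto intro!: bexI[of _ "x - y"])
  then show ?thesis
    using F.repr_independence[OF _ _ subgroup_N, of x y] assms by simp
qed

lemma balanced_pure: "balanced K A B T pt"
  unfolding balanced_def
proof (intro conjI ballI)
  let ?c = "\<lambda>u. N #>\<^bsub>free_Abelian_group S\<^esub> u"
  have add: "?c (frag_of x + frag_of y) = ?c (frag_of x) \<otimes>\<^bsub>T\<^esub> ?c (frag_of y)"
    "Poly_Mapping.keys (frag_of x + frag_of y) \<subseteq> S" if "x \<in> S" "y \<in> S" for x y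
    using hom_mult[OF coset_hom, of "frag_of x" "frag_of y"] that keys_add[of "frag_of x" "frag_of y"]
    by auto
  {
    fix a a' b assume ab: "a \<in> carrier A" "a' \<in> carrier A" "b \<in> carrier B"
    have "?c (frag_of (a \<oplus>\<^bsub>A\<^esub> a', b)) = ?c (frag_of (a, b) + frag_of (a', b))"
      using ab add by (intro coset_eqI) (auto simp: tensor_relators_def diff_diff_eq[symmetric])
    with ab add show "pt (a \<oplus>\<^bsub>A\<^esub> a') b = pt a b \<otimes>\<^bsub>T\<^esub> pt a' b"
      by (simp add: pure_tensor_def)
  next
    fix a b b' assume ab: "a \<in> carrier A" "b \<in> carrier B" "b' \<in> carrier B"
    have "?c (frag_of (a, b \<oplus>\<^bsub>B\<^esub> b')) = ?c (frag_of (a, b) + frag_of (a, b'))"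
      using ab add by (intro coset_eqI) (auto simp: tensor_relators_def diff_diff_eq[symmetric])
    with ab add show "pt a (b \<oplus>\<^bsub>B\<^esub> b') = pt a b \<otimes>\<^bsub>T\<^esub> pt a b'"
      by (simp add: pure_tensor_def)
  next
    fix k a b assume ab: "k \<in> carrier K" "a \<in> carrier A" "b \<in> carrier B"
    have "?c (frag_of (k \<odot>\<^bsub>A\<^esub> a, b)) = ?c (frag_of (a, k \<odot>\<^bsub>B\<^esub> b))"
      using ab by (intro coset_eqI) (auto simp: tensor_relators_def)
    then show "pt (k \<odot>\<^bsub>A\<^esub> a) b = pt a (k \<odot>\<^bsub>B\<^esub> b)"
      by (simp add: pure_tensor_def)
  }
qed (rule pure_closed)

text \<open>Universal property: extend \<open>f\<close> from the generators to the free group;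
  balancedness puts every relator into the kernel, hence the subgroup they generate, and the map
  factors through the quotient.\<close>

lemma balanced_hom:
  assumes G: "comm_group G" and f: "balanced K A B G f"
  shows "\<exists>h \<in> hom T G. \<forall>a\<in>carrier A. \<forall>b\<in>carrier B. h (pt a b) = f a b"
proof -
  interpret G: comm_group G by fact
  have "(\<lambda>x. f (fst x) (snd x)) ` S \<subseteq> carrier G"
    using f by (auto simp: balanced_def)
  then obtain g where g: "g \<in> hom (free_Abelian_group S) G"
    "\<And>x. x \<in> S \<Longrightarrow> g (frag_of x) = f (fst x) (snd x)"
    using G.free_Abelian_group_universal by blast
  interpret g: group_hom "free_Abelian_group S" G g
    using g by (simp add: group_hom_def group_hom_axioms_def)
  have diff: "g (x - y) = g x \<otimes>\<^bsub>G\<^esub> inv\<^bsub>G\<^esub> g y" "Poly_Mapping.keys (x - y) \<subseteq> S"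
    if "Poly_Mapping.keys x \<subseteq> S" "Poly_Mapping.keys y \<subseteq> S" for x y
    using g.hom_mult[of x "inv\<^bsub>free_Abelian_group S\<^esub> y"] g.hom_inv[of y] that keys_diff[of x y]
    by auto
  have cancel: "u \<otimes>\<^bsub>G\<^esub> v \<otimes>\<^bsub>G\<^esub> inv\<^bsub>G\<^esub> u \<otimes>\<^bsub>G\<^esub> inv\<^bsub>G\<^esub> v = \<one>\<^bsub>G\<^esub>"
    if "u \<in> carrier G" "v \<in> carrier G" for u v
    using that by (simp add: G.m_comm[of u v] G.m_assoc[of v u] G.r_inv)
  have gf: "g (frag_of (a, b)) = f a b" if "a \<in> carrier A" "b \<in> carrier B" for a b
    using g(2) that by simp
  \<comment> \<open>\<open>k2\<close> handles the two-term relators of scalar balance,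
    \<open>k3\<close> the three-term relators of additivity in either argument.\<close>
  have k2: "x - y \<in> kernel (free_Abelian_group S) G g"
    if "Poly_Mapping.keys x \<subseteq> S" "Poly_Mapping.keys y \<subseteq> S" "g x = g y" "g y \<in> carrier G" for x y
    using that diff[of x y] by (simp add: kernel_def G.r_inv)
  have k3: "x - y - z \<in> kernel (free_Abelian_group S) G g"
    if "Poly_Mapping.keys x \<subseteq> S" "Poly_Mapping.keys y \<subseteq> S" "Poly_Mapping.keys z \<subseteq> S"
      "g x = g y \<otimes>\<^bsub>G\<^esub> g z" "g y \<in> carrier G" "g z \<in> carrier G" for x y z
    using that diff[of x y] diff[of "x - y" z] by (simp add: kernel_def cancel)
  have "tensor_relators K A B \<subseteq> kernel (free_Abelian_group S) G g"
    unfolding tensor_relators_def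
    by (intro Un_least; use f in \<open>unfold balanced_def\<close>;
      (auto intro!: k3 simp: gf; fail)?; auto intro!: k2 simp: gf)
  then have "N \<subseteq> kernel (free_Abelian_group S) G g"
    unfolding tensor_subgroup_def
    by (rule group.generate_subgroup_incl[OF group_free_Abelian_group _ g.subgroup_kernel])
  from g.FactGroup_universal_kernel[OF normal_N this] obtain h
    where h: "h \<in> hom T G" "\<And>x. x \<in> carrier (free_Abelian_group S) \<Longrightarrow> h (N #>\<^bsub>free_Abelian_group S\<^esub> x) = g x"
    unfolding tensor_group_def by blast
  show ?thesis
    using h g by (intro bexI[OF _ h(1)]) (auto simp: pure_tensor_def)
qed

end

section \<open>Additive, linear and multiplicative maps\<close>

text \<open>Only sums are recorded because comparison on pure tensors needs no more, and because D
  \<otimes> id and id \<otimes> U into the product with the opposite algebra preserve sums but not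
  products.\<close>

definition add_hom :: "('a, 'm) ring_scheme \<Rightarrow> ('b, 'n) ring_scheme \<Rightarrow> ('a \<Rightarrow> 'b) set" where
  "add_hom A B = {h \<in> carrier A \<rightarrow> carrier B.
    \<forall>x\<in>carrier A. \<forall>y\<in>carrier A. h (x \<oplus>\<^bsub>A\<^esub> y) = h x \<oplus>\<^bsub>B\<^esub> h y}"

lemma add_homI:
  assumes "\<And>x. x \<in> carrier A \<Longrightarrow> h x \<in> carrier B"
    and "\<And>x y. x \<in> carrier A \<Longrightarrow> y \<in> carrier A \<Longrightarrow> h (x \<oplus>\<^bsub>A\<^esub> y) = h x \<oplus>\<^bsub>B\<^esub> h y"
  shows "h \<in> add_hom A B"
  using assms by (simp add: add_hom_def)

lemma add_homD:
  assumes "h \<in> add_hom A B"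
  shows "x \<in> carrier A \<Longrightarrow> h x \<in> carrier B"
    and "x \<in> carrier A \<Longrightarrow> y \<in> carrier A \<Longrightarrow> h (x \<oplus>\<^bsub>A\<^esub> y) = h x \<oplus>\<^bsub>B\<^esub> h y"
  using assms by (auto simp: add_hom_def)

lemma add_hom_compose:
  "f \<in> add_hom A B \<Longrightarrow> g \<in> add_hom B C \<Longrightarrow> (\<lambda>x. g (f x)) \<in> add_hom A C"
  by (simp add: add_hom_def Pi_def)

lemma (in ring) add_hom_mult_left:
  "h \<in> add_hom A R \<Longrightarrow> x \<in> carrier R \<Longrightarrow> (\<lambda>t. x \<otimes> h t) \<in> add_hom A R"
  by (simp add: add_hom_def Pi_def r_distr)

lemma (in ring) add_hom_mult_right:
  "h \<in> add_hom A R \<Longrightarrow> x \<in> carrier R \<Longrightarrow> (\<lambda>t. h t \<otimes> x) \<in> add_hom A R"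
  by (simp add: add_hom_def Pi_def l_distr)

lemma tensor_algebra_simps:
  "carrier (tensor_algebra K A B) = carrier (tensor_group K A B)"
  "\<zero>\<^bsub>tensor_algebra K A B\<^esub> = \<one>\<^bsub>tensor_group K A B\<^esub>"
  "x \<oplus>\<^bsub>tensor_algebra K A B\<^esub> y = x \<otimes>\<^bsub>tensor_group K A B\<^esub> y"
  "\<one>\<^bsub>tensor_algebra K A B\<^esub> = pure_tensor K A B \<one>\<^bsub>A\<^esub> \<one>\<^bsub>B\<^esub>"
  by (simp_all add: tensor_algebra_def)

definition linear_maps ::
    "('k, 'm) ring_scheme \<Rightarrow> ('k, 'a, 'n) module_scheme \<Rightarrow> ('k, 'b, 'o) module_scheme \<Rightarrow> ('a \<Rightarrow> 'b) set" where
  "linear_maps K A B =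
    {f \<in> add_hom A B. \<forall>k\<in>carrier K. \<forall>x\<in>carrier A. f (k \<odot>\<^bsub>A\<^esub> x) = k \<odot>\<^bsub>B\<^esub> f x}"

definition algebra_homs ::
    "('k, 'm) ring_scheme \<Rightarrow> ('k, 'a, 'n) module_scheme \<Rightarrow> ('k, 'b, 'o) module_scheme \<Rightarrow> ('a \<Rightarrow> 'b) set" where
  "algebra_homs K A B =
    {f \<in> ring_hom A B. \<forall>k\<in>carrier K. \<forall>x\<in>carrier A. f (k \<odot>\<^bsub>A\<^esub> x) = k \<odot>\<^bsub>B\<^esub> f x}"

text \<open>This is f \<otimes> g followed by the multiplication of \<open>C\<close>. With slot
  embeddings for \<open>f\<close> and \<open>g\<close> it is the leg notation t_ij, in a form that
  makes sense in every algebra.\<close>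

definition tensor_lift ::
    "('k, 'c, 'n) module_scheme \<Rightarrow> ('a \<Rightarrow> 'c) \<Rightarrow> ('b \<Rightarrow> 'c) \<Rightarrow> ('a \<times> 'b \<Rightarrow>\<^sub>0 int) set \<Rightarrow> 'c" where
  "tensor_lift C f g = tensor_sum (add_monoid C) (\<lambda>a b. f a \<otimes>\<^bsub>C\<^esub> g b)"

lemma algebra_homsI:
  assumes "\<And>x. x \<in> carrier A \<Longrightarrow> f x \<in> carrier B"
    and "\<And>x y. x \<in> carrier A \<Longrightarrow> y \<in> carrier A \<Longrightarrow> f (x \<otimes>\<^bsub>A\<^esub> y) = f x \<otimes>\<^bsub>B\<^esub> f y"
    and "\<And>x y. x \<in> carrier A \<Longrightarrow> y \<in> carrier A \<Longrightarrow> f (x \<oplus>\<^bsub>A\<^esub> y) = f x \<oplus>\<^bsub>B\<^esub> f y"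
    and "f \<one>\<^bsub>A\<^esub> = \<one>\<^bsub>B\<^esub>"
    and "\<And>k x. k \<in> carrier K \<Longrightarrow> x \<in> carrier A \<Longrightarrow> f (k \<odot>\<^bsub>A\<^esub> x) = k \<odot>\<^bsub>B\<^esub> f x"
  shows "f \<in> algebra_homs K A B"
  using assms by (auto simp: algebra_homs_def ring_hom_def)

lemma algebra_homsD:
  assumes "f \<in> algebra_homs K A B"
  shows "x \<in> carrier A \<Longrightarrow> f x \<in> carrier B"
    and "x \<in> carrier A \<Longrightarrow> y \<in> carrier A \<Longrightarrow> f (x \<otimes>\<^bsub>A\<^esub> y) = f x \<otimes>\<^bsub>B\<^esub> f y"
    and "x \<in> carrier A \<Longrightarrow> y \<in> carrier A \<Longrightarrow> f (x \<oplus>\<^bsub>A\<^esub> y) = f x \<oplus>\<^bsub>B\<^esub> f y"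
    and "f \<one>\<^bsub>A\<^esub> = \<one>\<^bsub>B\<^esub>"
    and "k \<in> carrier K \<Longrightarrow> x \<in> carrier A \<Longrightarrow> f (k \<odot>\<^bsub>A\<^esub> x) = k \<odot>\<^bsub>B\<^esub> f x"
  using assms by (auto simp: algebra_homs_def ring_hom_def)

lemma linear_mapsD:
  assumes "f \<in> linear_maps K A B"
  shows "x \<in> carrier A \<Longrightarrow> f x \<in> carrier B"
    and "x \<in> carrier A \<Longrightarrow> y \<in> carrier A \<Longrightarrow> f (x \<oplus>\<^bsub>A\<^esub> y) = f x \<oplus>\<^bsub>B\<^esub> f y"
    and "k \<in> carrier K \<Longrightarrow> x \<in> carrier A \<Longrightarrow> f (k \<odot>\<^bsub>A\<^esub> x) = k \<odot>\<^bsub>B\<^esub> f x"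
  using assms by (auto simp: linear_maps_def add_hom_def)

lemma linear_maps_compose:
  "f \<in> linear_maps K A B \<Longrightarrow> g \<in> linear_maps K B C \<Longrightarrow> (\<lambda>x. g (f x)) \<in> linear_maps K A C"
  by (auto simp: linear_maps_def add_hom_def Pi_def)

lemma id_linear: "id \<in> linear_maps K A A"
  by (simp add: linear_maps_def add_hom_def)

lemma algebra_homs_linear: "f \<in> algebra_homs K A B \<Longrightarrow> f \<in> linear_maps K A B"
  by (auto simp: algebra_homs_def linear_maps_def add_hom_def ring_hom_def)

lemma algebra_homs_add_hom: "f \<in> algebra_homs K A B \<Longrightarrow> f \<in> add_hom A B"
  by (auto simp: algebra_homs_def add_hom_def ring_hom_def)

lemma algebra_homs_compose:
  "f \<in> algebra_homs K A B \<Longrightarrow> g \<in> algebra_homs K B C \<Longrightarrow> (\<lambda>x. g (f x)) \<in> algebra_homs K A C"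
  by (auto simp: algebra_homs_def ring_hom_def Pi_def)

context tensor_product
begin

abbreviation "TA \<equiv> tensor_algebra K A B"

lemma tensor_sum_balanced:
  assumes G: "comm_group G" and f: "balanced K A B G f"
  shows "tensor_sum G f \<in> hom T G"
    and "a \<in> carrier A \<Longrightarrow> b \<in> carrier B \<Longrightarrow> tensor_sum G f (pt a b) = f a b"
proof -
  from balanced_hom[OF G f] obtain h where h: "h \<in> hom T G"
    "\<And>a b. a \<in> carrier A \<Longrightarrow> b \<in> carrier B \<Longrightarrow> h (pt a b) = f a b" by blast
  have eq: "tensor_sum G f t = h t" if "t \<in> carrier T" for t
    using tensor_sum_hom[OF G h(1) that] h(2) by simp
  have "group T" using comm_group_tensor_group by (rule comm_group.axioms)
  then have cl: "x \<otimes>\<^bsub>T\<^esub> y \<in> carrier T" if "x \<in> carrier T" "y \<in> carrier T" for x y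
    using that by (simp add: group.is_monoid monoid.m_closed)
  show "tensor_sum G f \<in> hom T G"
    using h(1) by (auto simp: hom_def eq cl)
  show "a \<in> carrier A \<Longrightarrow> b \<in> carrier B \<Longrightarrow> tensor_sum G f (pt a b) = f a b"
    using h(2) by (simp add: eq pure_closed)
qed

lemma abelian_group_tensor: "abelian_group TA"
proof -
  interpret T: comm_group T by (rule comm_group_tensor_group)
  show ?thesis
    by (rule abelian_groupI) (auto simp: tensor_algebra_simps T.m_ac intro: T.l_inv_ex)
qed

lemma add_hom_iff: "add_hom TA C = hom T (add_monoid C)"
  by (auto simp: add_hom_def hom_def tensor_algebra_simps)

lemma pure_in_tensor [simp]: "a \<in> carrier A \<Longrightarrow> b \<in> carrier B \<Longrightarrow> pt a b \<in> carrier TA"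
  by (simp add: tensor_algebra_simps pure_closed)

lemma pure_add_left:
  "a \<in> carrier A \<Longrightarrow> a' \<in> carrier A \<Longrightarrow> b \<in> carrier B \<Longrightarrow> pt (a \<oplus>\<^bsub>A\<^esub> a') b = pt a b \<oplus>\<^bsub>TA\<^esub> pt a' b"
  using balanced_pure by (simp add: balanced_def tensor_algebra_simps)

lemma pure_add_right:
  "a \<in> carrier A \<Longrightarrow> b \<in> carrier B \<Longrightarrow> b' \<in> carrier B \<Longrightarrow> pt a (b \<oplus>\<^bsub>B\<^esub> b') = pt a b \<oplus>\<^bsub>TA\<^esub> pt a b'"
  using balanced_pure by (simp add: balanced_def tensor_algebra_simps)

lemma pure_balance:
  "k \<in> carrier K \<Longrightarrow> a \<in> carrier A \<Longrightarrow> b \<in> carrier B \<Longrightarrow> pt a (k \<odot>\<^bsub>B\<^esub> b) = pt (k \<odot>\<^bsub>A\<^esub> a) b"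
  using balanced_pure by (simp add: balanced_def)

text \<open>Additive form of \<open>hom_ext\<close>. Identities in several tensors are reduced to
  pure tensors by applying it to one variable at a time.\<close>

lemma tensor_eqI:
  assumes "abelian_group C" "h \<in> add_hom TA C" "h' \<in> add_hom TA C"
    and "\<And>a b. a \<in> carrier A \<Longrightarrow> b \<in> carrier B \<Longrightarrow> h (pt a b) = h' (pt a b)"
    and "t \<in> carrier TA"
  shows "h t = h' t"
proof -
  interpret C: abelian_group C by fact
  show ?thesis
    using hom_ext[OF C.a_group, of h h' t] assms by (simp add: add_hom_iff tensor_algebra_simps)
qed

text \<open>\<open>G\<close> and \<open>C\<close> are two records for one abelian group,
  multiplicative and additive: the definitions sum in \<open>tensor_group\<close> or in
  \<open>add_monoid\<close>, while the results are wanted as additive maps into an algebra.\<close>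

lemma tensor_sum_tensor_group:
  assumes f: "\<And>a b. a \<in> carrier A \<Longrightarrow> b \<in> carrier B \<Longrightarrow> f a b \<in> carrier C"
    "\<And>a a' b. a \<in> carrier A \<Longrightarrow> a' \<in> carrier A \<Longrightarrow> b \<in> carrier B \<Longrightarrow> f (a \<oplus>\<^bsub>A\<^esub> a') b = f a b \<oplus>\<^bsub>C\<^esub> f a' b"
    "\<And>a b b'. a \<in> carrier A \<Longrightarrow> b \<in> carrier B \<Longrightarrow> b' \<in> carrier B \<Longrightarrow> f a (b \<oplus>\<^bsub>B\<^esub> b') = f a b \<oplus>\<^bsub>C\<^esub> f a b'"
    "\<And>k a b. k \<in> carrier K \<Longrightarrow> a \<in> carrier A \<Longrightarrow> b \<in> carrier B \<Longrightarrow> f (k \<odot>\<^bsub>A\<^esub> a) b = f a (k \<odot>\<^bsub>B\<^esub> b)"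
    and G: "comm_group G" "carrier G = carrier C" "monoid.mult G = ring.add C"
  shows "tensor_sum G f \<in> add_hom TA C"
    and "a \<in> carrier A \<Longrightarrow> b \<in> carrier B \<Longrightarrow> tensor_sum G f (pt a b) = f a b"
proof -
  have "balanced K A B G f" using f G by (simp add: balanced_def)
  note * = tensor_sum_balanced[OF G(1) this]
  show "tensor_sum G f \<in> add_hom TA C" using *(1) G
    by (simp add: add_hom_iff hom_def)
  show "a \<in> carrier A \<Longrightarrow> b \<in> carrier B \<Longrightarrow> tensor_sum G f (pt a b) = f a b" by (rule *(2))
qed

lemma tensor_sum_eq:
  assumes h: "h \<in> add_hom TA C"
    and f: "\<And>a b. a \<in> carrier A \<Longrightarrow> b \<in> carrier B \<Longrightarrow> f a b = h (pt a b)"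
    and G: "comm_group G" "carrier G = carrier C" "monoid.mult G = ring.add C"
    and t: "t \<in> carrier TA"
  shows "tensor_sum G f t = h t"
proof (rule tensor_sum_hom[OF G(1)])
  show "h \<in> hom T G" using h by (simp add: add_hom_iff hom_def G)
qed (use t f in \<open>auto simp: tensor_algebra_simps\<close>)

lemma tensor_sum_self:
  assumes "\<And>a b. a \<in> carrier A \<Longrightarrow> b \<in> carrier B \<Longrightarrow> f a b \<in> carrier TA"
    "\<And>a a' b. a \<in> carrier A \<Longrightarrow> a' \<in> carrier A \<Longrightarrow> b \<in> carrier B \<Longrightarrow> f (a \<oplus>\<^bsub>A\<^esub> a') b = f a b \<oplus>\<^bsub>TA\<^esub> f a' b"
    "\<And>a b b'. a \<in> carrier A \<Longrightarrow> b \<in> carrier B \<Longrightarrow> b' \<in> carrier B \<Longrightarrow> f a (b \<oplus>\<^bsub>B\<^esub> b') = f a b \<oplus>\<^bsub>TA\<^esub> f a b'"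
    "\<And>k a b. k \<in> carrier K \<Longrightarrow> a \<in> carrier A \<Longrightarrow> b \<in> carrier B \<Longrightarrow> f (k \<odot>\<^bsub>A\<^esub> a) b = f a (k \<odot>\<^bsub>B\<^esub> b)"
  shows "tensor_sum T f \<in> add_hom TA TA \<and>
    (\<forall>a\<in>carrier A. \<forall>b\<in>carrier B. tensor_sum T f (pt a b) = f a b)"
proof -
  have "carrier T = carrier TA" "monoid.mult T = ring.add TA"
    by (simp_all add: tensor_algebra_def)
  note * = tensor_sum_tensor_group[OF assms comm_group_tensor_group this]
  show ?thesis using *(1) *(2) by blast
qed

lemma smult_tensor:
  assumes k: "k \<in> carrier K"
  shows "(\<lambda>t. k \<odot>\<^bsub>TA\<^esub> t) \<in> add_hom TA TA"
    and "a \<in> carrier A \<Longrightarrow> b \<in> carrier B \<Longrightarrow> k \<odot>\<^bsub>TA\<^esub> pt a b = pt (k \<odot>\<^bsub>A\<^esub> a) b"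
proof -
  have eq: "(\<lambda>t. k \<odot>\<^bsub>TA\<^esub> t) = tensor_sum T (\<lambda>a b. pt (k \<odot>\<^bsub>A\<^esub> a) b)"
    by (simp add: tensor_algebra_def)
  have "tensor_sum T (\<lambda>a b. pt (k \<odot>\<^bsub>A\<^esub> a) b) \<in> add_hom TA TA \<and>
    (\<forall>a\<in>carrier A. \<forall>b\<in>carrier B. tensor_sum T (\<lambda>a b. pt (k \<odot>\<^bsub>A\<^esub> a) b) (pt a b) = pt (k \<odot>\<^bsub>A\<^esub> a) b)"
  proof (rule tensor_sum_self)
    show "pt (k \<odot>\<^bsub>A\<^esub> (l \<odot>\<^bsub>A\<^esub> a)) b = pt (k \<odot>\<^bsub>A\<^esub> a) (l \<odot>\<^bsub>B\<^esub> b)"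
      if "l \<in> carrier K" "a \<in> carrier A" "b \<in> carrier B" for l a b
      using that k by (simp add: pure_balance A.smult_assoc1[symmetric] A.R.m_comm)
  qed (use k in \<open>auto simp: A.smult_r_distr pure_add_left pure_add_right\<close>)
  then show "(\<lambda>t. k \<odot>\<^bsub>TA\<^esub> t) \<in> add_hom TA TA"
    and "a \<in> carrier A \<Longrightarrow> b \<in> carrier B \<Longrightarrow> k \<odot>\<^bsub>TA\<^esub> pt a b = pt (k \<odot>\<^bsub>A\<^esub> a) b"
    using fun_cong[OF eq] by (auto simp: eq)
qed

lemma module_tensor: "module K TA"
proof -
  interpret TA: abelian_group TA by (rule abelian_group_tensor)
  note cl = add_homD(1)[OF smult_tensor(1)] and distr = add_homD(2)[OF smult_tensor(1)]
  show ?thesis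
  proof (rule moduleI)
    show "cring K" by (rule A.R.is_cring)
    show "abelian_group TA" by (rule abelian_group_tensor)
    show "k \<odot>\<^bsub>TA\<^esub> t \<in> carrier TA" if "k \<in> carrier K" "t \<in> carrier TA" for k t
      using that by (rule cl)
    show "k \<odot>\<^bsub>TA\<^esub> (t \<oplus>\<^bsub>TA\<^esub> t') = k \<odot>\<^bsub>TA\<^esub> t \<oplus>\<^bsub>TA\<^esub> k \<odot>\<^bsub>TA\<^esub> t'"
      if "k \<in> carrier K" "t \<in> carrier TA" "t' \<in> carrier TA" for k t t'
      using that by (rule distr)
    show "(k \<oplus> l) \<odot>\<^bsub>TA\<^esub> t = k \<odot>\<^bsub>TA\<^esub> t \<oplus>\<^bsub>TA\<^esub> l \<odot>\<^bsub>TA\<^esub> t"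
      if kl: "k \<in> carrier K" "l \<in> carrier K" and t: "t \<in> carrier TA" for k l t
      by (rule tensor_eqI[OF abelian_group_tensor _ _ _ t, where h = "\<lambda>t. (k \<oplus> l) \<odot>\<^bsub>TA\<^esub> t"])
        (use kl in \<open>auto intro!: add_homI simp: cl distr TA.a_ac smult_tensor(2) A.smult_l_distr pure_add_left\<close>)
    show "(k \<otimes> l) \<odot>\<^bsub>TA\<^esub> t = k \<odot>\<^bsub>TA\<^esub> (l \<odot>\<^bsub>TA\<^esub> t)"
      if kl: "k \<in> carrier K" "l \<in> carrier K" and t: "t \<in> carrier TA" for k l t
      by (rule tensor_eqI[OF abelian_group_tensor _ _ _ t, where h = "\<lambda>t. (k \<otimes> l) \<odot>\<^bsub>TA\<^esub> t"])
        (use kl in \<open>auto intro!: add_homI simp: cl distr smult_tensor(2) A.smult_assoc1\<close>)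
    show "\<one> \<odot>\<^bsub>TA\<^esub> t = t" if t: "t \<in> carrier TA" for t
      by (rule tensor_eqI[OF abelian_group_tensor _ _ _ t, where h = "\<lambda>t. \<one> \<odot>\<^bsub>TA\<^esub> t"])
        (auto intro!: add_homI simp: cl distr smult_tensor(2))
  qed
qed

end

section \<open>Tensor products of algebras\<close>

locale algebra_product = A: assoc_algebra K A + B: assoc_algebra K B
  for K (structure) and A B
begin

sublocale tensor_product K A B
  by (intro tensor_product.intro A.module_axioms B.module_axioms)

text \<open>The product of \<open>TA\<close> is a nested sum; \<open>L\<close> is its inner sum,
  left multiplication by a fixed pure tensor.\<close>

lemma pure_mult_aux:
  assumes ab: "a \<in> carrier A" "b \<in> carrier B"
  defines "L \<equiv> tensor_sum T (\<lambda>c d. pt (a \<otimes>\<^bsub>A\<^esub> c) (b \<otimes>\<^bsub>B\<^esub> d))"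
  shows "L \<in> add_hom TA TA"
    and "c \<in> carrier A \<Longrightarrow> d \<in> carrier B \<Longrightarrow> L (pt c d) = pt (a \<otimes>\<^bsub>A\<^esub> c) (b \<otimes>\<^bsub>B\<^esub> d)"
proof -
  have "L \<in> add_hom TA TA \<and>
    (\<forall>c\<in>carrier A. \<forall>d\<in>carrier B. L (pt c d) = pt (a \<otimes>\<^bsub>A\<^esub> c) (b \<otimes>\<^bsub>B\<^esub> d))"
    unfolding L_def
    by (rule tensor_sum_self) (use ab in \<open>auto simp: A.alg.r_distr B.alg.r_distr A.smult_mult_right B.smult_mult_right
      pure_balance pure_add_left pure_add_right\<close>)
  then show "L \<in> add_hom TA TA"
    and "c \<in> carrier A \<Longrightarrow> d \<in> carrier B \<Longrightarrow> L (pt c d) = pt (a \<otimes>\<^bsub>A\<^esub> c) (b \<otimes>\<^bsub>B\<^esub> d)"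
    by auto
qed

text \<open>The outer sum of the product is well defined once the inner value at \<open>t\<close> is
  additive and balanced in the pair \<open>a\<close>, \<open>b\<close>. Each of these conditions is
  an identity of additive maps in \<open>t\<close>, checked on pure tensors.\<close>

lemma mult_tensor_left:
  assumes t: "t \<in> carrier TA"
  shows "(\<lambda>s. s \<otimes>\<^bsub>TA\<^esub> t) \<in> add_hom TA TA"
    and "a \<in> carrier A \<Longrightarrow> b \<in> carrier B \<Longrightarrow>
      pt a b \<otimes>\<^bsub>TA\<^esub> t = tensor_sum T (\<lambda>c d. pt (a \<otimes>\<^bsub>A\<^esub> c) (b \<otimes>\<^bsub>B\<^esub> d)) t"
proof -
  interpret TA: abelian_group TA by (rule abelian_group_tensor)
  let ?L = "\<lambda>a b. tensor_sum T (\<lambda>c d. pt (a \<otimes>\<^bsub>A\<^esub> c) (b \<otimes>\<^bsub>B\<^esub> d))"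
  note cl = add_homD(1)[OF pure_mult_aux(1)] and distr = add_homD(2)[OF pure_mult_aux(1)]
  have eq: "(\<lambda>s. s \<otimes>\<^bsub>TA\<^esub> t) = tensor_sum T (\<lambda>a b. ?L a b t)"
    by (simp add: tensor_algebra_def)
  have "tensor_sum T (\<lambda>a b. ?L a b t) \<in> add_hom TA TA \<and>
    (\<forall>a\<in>carrier A. \<forall>b\<in>carrier B. tensor_sum T (\<lambda>a b. ?L a b t) (pt a b) = ?L a b t)"
  proof (rule tensor_sum_self)
    show "?L (a \<oplus>\<^bsub>A\<^esub> a') b t = ?L a b t \<oplus>\<^bsub>TA\<^esub> ?L a' b t"
      if "a \<in> carrier A" "a' \<in> carrier A" "b \<in> carrier B" for a a' b
      by (rule tensor_eqI[OF abelian_group_tensor _ _ _ t, where h = "?L (a \<oplus>\<^bsub>A\<^esub> a') b"])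
        (use that in \<open>auto intro!: add_homI simp: cl distr TA.a_ac pure_mult_aux(2) A.alg.l_distr pure_add_left\<close>)
    show "?L a (b \<oplus>\<^bsub>B\<^esub> b') t = ?L a b t \<oplus>\<^bsub>TA\<^esub> ?L a b' t"
      if "a \<in> carrier A" "b \<in> carrier B" "b' \<in> carrier B" for a b b'
      by (rule tensor_eqI[OF abelian_group_tensor _ _ _ t, where h = "?L a (b \<oplus>\<^bsub>B\<^esub> b')"])
        (use that in \<open>auto intro!: add_homI simp: cl distr TA.a_ac pure_mult_aux(2) B.alg.l_distr pure_add_right\<close>)
    show "?L (k \<odot>\<^bsub>A\<^esub> a) b t = ?L a (k \<odot>\<^bsub>B\<^esub> b) t"
      if "k \<in> carrier K" "a \<in> carrier A" "b \<in> carrier B" for k a b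
      by (rule tensor_eqI[OF abelian_group_tensor _ _ _ t, where h = "?L (k \<odot>\<^bsub>A\<^esub> a) b"])
        (use that in \<open>auto intro!: add_homI simp: cl distr pure_mult_aux(2) A.smult_mult_left B.smult_mult_left pure_balance\<close>)
  qed (use t in \<open>auto simp: cl\<close>)
  then show "(\<lambda>s. s \<otimes>\<^bsub>TA\<^esub> t) \<in> add_hom TA TA"
    and "a \<in> carrier A \<Longrightarrow> b \<in> carrier B \<Longrightarrow> pt a b \<otimes>\<^bsub>TA\<^esub> t = ?L a b t"
    using fun_cong[OF eq] by (auto simp: eq)
qed

lemma mult_pure:
  assumes "a \<in> carrier A" "b \<in> carrier B" "c \<in> carrier A" "d \<in> carrier B"
  shows "pt a b \<otimes>\<^bsub>TA\<^esub> pt c d = pt (a \<otimes>\<^bsub>A\<^esub> c) (b \<otimes>\<^bsub>B\<^esub> d)"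
  using assms by (simp add: mult_tensor_left(2) pure_mult_aux(2))

lemma mult_tensor_right:
  assumes s: "s \<in> carrier TA"
  shows "(\<lambda>t. s \<otimes>\<^bsub>TA\<^esub> t) \<in> add_hom TA TA"
proof (rule add_homI)
  interpret TA: abelian_group TA by (rule abelian_group_tensor)
  note cl = add_homD(1)[OF mult_tensor_left(1)] and distr = add_homD(2)[OF mult_tensor_left(1)]
  show "s \<otimes>\<^bsub>TA\<^esub> t \<in> carrier TA" if "t \<in> carrier TA" for t
    using cl[OF that s] .
  show "s \<otimes>\<^bsub>TA\<^esub> (t \<oplus>\<^bsub>TA\<^esub> t') = s \<otimes>\<^bsub>TA\<^esub> t \<oplus>\<^bsub>TA\<^esub> s \<otimes>\<^bsub>TA\<^esub> t'"
    if t: "t \<in> carrier TA" "t' \<in> carrier TA" for t t'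
    by (rule tensor_eqI[OF abelian_group_tensor _ _ _ s, where h = "\<lambda>s. s \<otimes>\<^bsub>TA\<^esub> (t \<oplus>\<^bsub>TA\<^esub> t')"])
      (use t in \<open>auto intro!: add_homI simp: cl distr TA.a_ac mult_tensor_left(2)
        add_homD[OF pure_mult_aux(1)]\<close>)
qed

lemma ring_tensor: "ring TA"
proof -
  interpret TA: abelian_group TA by (rule abelian_group_tensor)
  note cl = add_homD(1)[OF mult_tensor_right]
    and l_distr = add_homD(2)[OF mult_tensor_left(1)] and r_distr = add_homD(2)[OF mult_tensor_right]
  show ?thesis
  proof (rule ringI)
    show "monoid TA"
    proof (rule monoidI)
      show "\<one>\<^bsub>TA\<^esub> \<in> carrier TA" by (simp add: tensor_algebra_simps pure_closed)
      show one_l: "\<one>\<^bsub>TA\<^esub> \<otimes>\<^bsub>TA\<^esub> t = t" if t: "t \<in> carrier TA" for t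
        by (rule tensor_eqI[OF abelian_group_tensor _ _ _ t, where h = "\<lambda>t. \<one>\<^bsub>TA\<^esub> \<otimes>\<^bsub>TA\<^esub> t"])
          (auto intro!: add_homI simp: cl r_distr mult_pure tensor_algebra_simps(4))
      show "t \<otimes>\<^bsub>TA\<^esub> \<one>\<^bsub>TA\<^esub> = t" if t: "t \<in> carrier TA" for t
        by (rule tensor_eqI[OF abelian_group_tensor _ _ _ t, where h = "\<lambda>t. t \<otimes>\<^bsub>TA\<^esub> \<one>\<^bsub>TA\<^esub>"])
          (auto intro!: add_homI simp: cl l_distr mult_pure tensor_algebra_simps(4))
      fix x y z assume xyz: "x \<in> carrier TA" "y \<in> carrier TA" "z \<in> carrier TA"
      show "x \<otimes>\<^bsub>TA\<^esub> y \<in> carrier TA" using xyz cl by blast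
      show "x \<otimes>\<^bsub>TA\<^esub> y \<otimes>\<^bsub>TA\<^esub> z = x \<otimes>\<^bsub>TA\<^esub> (y \<otimes>\<^bsub>TA\<^esub> z)"
      proof (rule tensor_eqI[OF abelian_group_tensor _ _ _ xyz(1), where h = "\<lambda>x. x \<otimes>\<^bsub>TA\<^esub> y \<otimes>\<^bsub>TA\<^esub> z"])
        fix a b assume ab: "a \<in> carrier A" "b \<in> carrier B"
        show "pt a b \<otimes>\<^bsub>TA\<^esub> y \<otimes>\<^bsub>TA\<^esub> z = pt a b \<otimes>\<^bsub>TA\<^esub> (y \<otimes>\<^bsub>TA\<^esub> z)"
        proof (rule tensor_eqI[OF abelian_group_tensor _ _ _ xyz(2), where h = "\<lambda>y. pt a b \<otimes>\<^bsub>TA\<^esub> y \<otimes>\<^bsub>TA\<^esub> z"])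
          fix c d assume cd: "c \<in> carrier A" "d \<in> carrier B"
          show "pt a b \<otimes>\<^bsub>TA\<^esub> pt c d \<otimes>\<^bsub>TA\<^esub> z = pt a b \<otimes>\<^bsub>TA\<^esub> (pt c d \<otimes>\<^bsub>TA\<^esub> z)"
            by (rule tensor_eqI[OF abelian_group_tensor _ _ _ xyz(3), where h = "\<lambda>z. pt a b \<otimes>\<^bsub>TA\<^esub> pt c d \<otimes>\<^bsub>TA\<^esub> z"])
              (use ab cd in \<open>auto intro!: add_homI simp: cl r_distr mult_pure A.alg.m_assoc B.alg.m_assoc\<close>)
        qed (use ab xyz in \<open>auto intro!: add_homI simp: cl r_distr l_distr\<close>)
      qed (use xyz in \<open>auto intro!: add_homI simp: cl r_distr l_distr\<close>)
    qed
  qed (use abelian_group_tensor l_distr r_distr in auto)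
qed

sublocale TA: assoc_algebra K TA
proof -
  interpret TA: ring TA by (rule ring_tensor)
  interpret M: module K TA by (rule module_tensor)
  show "assoc_algebra K TA"
  proof (intro assoc_algebra.intro assoc_algebra_axioms.intro)
    show "field K" by (rule A.field_axioms)
    show "module K TA" by (rule module_tensor)
    show "ring TA" by (rule ring_tensor)
    fix k x y assume k: "k \<in> carrier K" and xy: "x \<in> carrier TA" "y \<in> carrier TA"
    show "k \<odot>\<^bsub>TA\<^esub> x \<otimes>\<^bsub>TA\<^esub> y = k \<odot>\<^bsub>TA\<^esub> (x \<otimes>\<^bsub>TA\<^esub> y)"
    proof (rule tensor_eqI[OF abelian_group_tensor _ _ _ xy(1), where h = "\<lambda>x. k \<odot>\<^bsub>TA\<^esub> x \<otimes>\<^bsub>TA\<^esub> y"])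
      fix a b assume ab: "a \<in> carrier A" "b \<in> carrier B"
      show "k \<odot>\<^bsub>TA\<^esub> pt a b \<otimes>\<^bsub>TA\<^esub> y = k \<odot>\<^bsub>TA\<^esub> (pt a b \<otimes>\<^bsub>TA\<^esub> y)"
        by (rule tensor_eqI[OF abelian_group_tensor _ _ _ xy(2), where h = "\<lambda>y. k \<odot>\<^bsub>TA\<^esub> pt a b \<otimes>\<^bsub>TA\<^esub> y"])
          (use k ab in \<open>auto intro!: add_homI simp: TA.r_distr M.smult_r_distr mult_pure smult_tensor(2)
            A.smult_mult_left\<close>)
    qed (use k xy in \<open>auto intro!: add_homI simp: TA.l_distr M.smult_r_distr\<close>)
    show "x \<otimes>\<^bsub>TA\<^esub> (k \<odot>\<^bsub>TA\<^esub> y) = k \<odot>\<^bsub>TA\<^esub> (x \<otimes>\<^bsub>TA\<^esub> y)"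
    proof (rule tensor_eqI[OF abelian_group_tensor _ _ _ xy(1), where h = "\<lambda>x. x \<otimes>\<^bsub>TA\<^esub> (k \<odot>\<^bsub>TA\<^esub> y)"])
      fix a b assume ab: "a \<in> carrier A" "b \<in> carrier B"
      show "pt a b \<otimes>\<^bsub>TA\<^esub> (k \<odot>\<^bsub>TA\<^esub> y) = k \<odot>\<^bsub>TA\<^esub> (pt a b \<otimes>\<^bsub>TA\<^esub> y)"
        by (rule tensor_eqI[OF abelian_group_tensor _ _ _ xy(2), where h = "\<lambda>y. pt a b \<otimes>\<^bsub>TA\<^esub> (k \<odot>\<^bsub>TA\<^esub> y)"])
          (use k ab in \<open>auto intro!: add_homI simp: TA.r_distr M.smult_r_distr mult_pure smult_tensor(2)
            A.smult_mult_right\<close>)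
    qed (use k xy in \<open>auto intro!: add_homI simp: TA.l_distr M.smult_r_distr\<close>)
  qed
qed

end

section \<open>Opposite algebras\<close>

lemma op_algebra_simps [simp]:
  "carrier (op_algebra A) = carrier A"
  "\<one>\<^bsub>op_algebra A\<^esub> = \<one>\<^bsub>A\<^esub>"
  "\<zero>\<^bsub>op_algebra A\<^esub> = \<zero>\<^bsub>A\<^esub>"
  "x \<oplus>\<^bsub>op_algebra A\<^esub> y = x \<oplus>\<^bsub>A\<^esub> y"
  "x \<otimes>\<^bsub>op_algebra A\<^esub> y = y \<otimes>\<^bsub>A\<^esub> x"
  "k \<odot>\<^bsub>op_algebra A\<^esub> x = k \<odot>\<^bsub>A\<^esub> x"
  by (simp_all add: op_algebra_def)

lemma op_op_algebra [simp]: "op_algebra (op_algebra A) = A"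
  by (simp add: op_algebra_def)

text \<open>The relators involve sums and scalars but no products, so reversing the multiplication
  leaves the underlying group untouched.\<close>

lemma tensor_group_op [simp]:
  "tensor_group K A (op_algebra B) = tensor_group K A B"
  "pure_tensor K A (op_algebra B) = pure_tensor K A B"
  by (auto simp: tensor_group_def pure_tensor_def tensor_subgroup_def tensor_relators_def fun_eq_iff)

lemma tensor_algebra_op [simp]:
  "carrier (tensor_algebra K A (op_algebra B)) = carrier (tensor_algebra K A B)"
  "\<one>\<^bsub>tensor_algebra K A (op_algebra B)\<^esub> = \<one>\<^bsub>tensor_algebra K A B\<^esub>"
  "x \<oplus>\<^bsub>tensor_algebra K A (op_algebra B)\<^esub> y = x \<oplus>\<^bsub>tensor_algebra K A B\<^esub> y"
  by (simp_all add: tensor_algebra_simps)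

lemma add_hom_op [simp]:
  "add_hom (op_algebra A) B = add_hom A B"
  "add_hom A (op_algebra B) = add_hom A B"
  "add_hom (tensor_algebra K A (op_algebra C)) B = add_hom (tensor_algebra K A C) B"
  by (simp_all add: add_hom_def)

lemma linear_maps_op [simp]:
  "linear_maps K (op_algebra A) B = linear_maps K A B"
  "linear_maps K A (op_algebra B) = linear_maps K A B"
  by (simp_all add: linear_maps_def)

lemma algebra_homs_op [simp]:
  "algebra_homs K (op_algebra A) (op_algebra B) = algebra_homs K A B"
  "algebra_homs K A (op_algebra B) = algebra_homs K (op_algebra A) B"
  by (auto simp: algebra_homs_def ring_hom_def)

lemma assoc_algebra_op:
  assumes "assoc_algebra K A"
  shows "assoc_algebra K (op_algebra A)"
proof -
  interpret A: assoc_algebra K A by fact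
  have ab: "abelian_group (op_algebra A)"
    by (rule abelian_groupI) (auto simp: A.M.a_ac intro: A.M.add.l_inv_ex)
  show ?thesis
  proof (intro assoc_algebra.intro assoc_algebra_axioms.intro)
    show "field K" by (rule A.field_axioms)
    show "module K (op_algebra A)"
      by (intro moduleI A.is_cring ab) (auto simp: A.smult_l_distr A.smult_r_distr A.smult_assoc1)
    show "ring (op_algebra A)"
      by (intro ringI ab monoidI) (auto simp: A.alg.m_assoc A.alg.l_distr A.alg.r_distr)
  qed (auto simp: A.smult_mult_left A.smult_mult_right)
qed

definition commuting_maps :: "('a, 'm) ring_scheme \<Rightarrow> 'b set \<Rightarrow> 'c set \<Rightarrow> ('b \<Rightarrow> 'a) \<Rightarrow> ('c \<Rightarrow> 'a) \<Rightarrow> bool" where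
  "commuting_maps C X Y f g \<longleftrightarrow> (\<forall>x\<in>X. \<forall>y\<in>Y. f x \<otimes>\<^bsub>C\<^esub> g y = g y \<otimes>\<^bsub>C\<^esub> f x)"

lemma commuting_mapsD:
  "commuting_maps C X Y f g \<Longrightarrow> x \<in> X \<Longrightarrow> y \<in> Y \<Longrightarrow> f x \<otimes>\<^bsub>C\<^esub> g y = g y \<otimes>\<^bsub>C\<^esub> f x"
  by (simp add: commuting_maps_def)

lemma commuting_maps_sym: "commuting_maps C X Y f g \<Longrightarrow> commuting_maps C Y X g f"
  by (simp add: commuting_maps_def)

lemma (in monoid) mult_four_swap:
  assumes "b \<otimes> c = c \<otimes> b" "a \<in> carrier G" "b \<in> carrier G" "c \<in> carrier G" "d \<in> carrier G"
  shows "(a \<otimes> b) \<otimes> (c \<otimes> d) = (a \<otimes> c) \<otimes> (b \<otimes> d)"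
proof -
  have "(a \<otimes> b) \<otimes> (c \<otimes> d) = a \<otimes> ((b \<otimes> c) \<otimes> d)" using assms(2-) by (simp add: m_assoc)
  then show ?thesis using assms(2-) by (simp add: m_assoc assms(1))
qed

section \<open>Lifting pairs of maps to the tensor product of algebras\<close>

context algebra_product
begin

lemma tensor_lift_linear:
  assumes C: "assoc_algebra K C" and f: "f \<in> linear_maps K A C" and g: "g \<in> linear_maps K B C"
  shows "tensor_lift C f g \<in> add_hom TA C"
    and "a \<in> carrier A \<Longrightarrow> b \<in> carrier B \<Longrightarrow> tensor_lift C f g (pt a b) = f a \<otimes>\<^bsub>C\<^esub> g b"
proof -
  interpret C: assoc_algebra K C by fact
  note fg = linear_mapsD[OF f] linear_mapsD[OF g]
  have *: "\<And>a b. a \<in> carrier A \<Longrightarrow> b \<in> carrier B \<Longrightarrow> f a \<otimes>\<^bsub>C\<^esub> g b \<in> carrier C"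
    "\<And>a a' b. a \<in> carrier A \<Longrightarrow> a' \<in> carrier A \<Longrightarrow> b \<in> carrier B \<Longrightarrow>
      f (a \<oplus>\<^bsub>A\<^esub> a') \<otimes>\<^bsub>C\<^esub> g b = f a \<otimes>\<^bsub>C\<^esub> g b \<oplus>\<^bsub>C\<^esub> f a' \<otimes>\<^bsub>C\<^esub> g b"
    "\<And>a b b'. a \<in> carrier A \<Longrightarrow> b \<in> carrier B \<Longrightarrow> b' \<in> carrier B \<Longrightarrow>
      f a \<otimes>\<^bsub>C\<^esub> g (b \<oplus>\<^bsub>B\<^esub> b') = f a \<otimes>\<^bsub>C\<^esub> g b \<oplus>\<^bsub>C\<^esub> f a \<otimes>\<^bsub>C\<^esub> g b'"
    "\<And>k a b. k \<in> carrier K \<Longrightarrow> a \<in> carrier A \<Longrightarrow> b \<in> carrier B \<Longrightarrow>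
      f (k \<odot>\<^bsub>A\<^esub> a) \<otimes>\<^bsub>C\<^esub> g b = f a \<otimes>\<^bsub>C\<^esub> g (k \<odot>\<^bsub>B\<^esub> b)"
    by (simp_all add: fg C.alg.l_distr C.alg.r_distr C.smult_mult_left C.smult_mult_right)
  have C': "comm_group (add_monoid C)" by (rule C.M.a_comm_group)
  note ** = tensor_sum_tensor_group[OF * C']
  show "tensor_lift C f g \<in> add_hom TA C"
    unfolding tensor_lift_def by (rule **(1)) simp_all
  show "a \<in> carrier A \<Longrightarrow> b \<in> carrier B \<Longrightarrow> tensor_lift C f g (pt a b) = f a \<otimes>\<^bsub>C\<^esub> g b"
    unfolding tensor_lift_def by (rule **(2)) simp_all
qed

lemma tensor_lift_unique:
  assumes "assoc_algebra K C" and h: "h \<in> add_hom TA C" and t: "t \<in> carrier TA"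
    and hp: "\<And>a b. a \<in> carrier A \<Longrightarrow> b \<in> carrier B \<Longrightarrow> h (pt a b) = f a \<otimes>\<^bsub>C\<^esub> g b"
  shows "h t = tensor_lift C f g t"
proof -
  interpret C: assoc_algebra K C by fact
  have "comm_group (add_monoid C)" by (rule C.M.a_comm_group)
  from tensor_sum_eq[OF h _ this _ _ t, of "\<lambda>a b. f a \<otimes>\<^bsub>C\<^esub> g b"] hp show ?thesis
    by (simp add: tensor_lift_def)
qed

lemma tensor_lift_commute:
  assumes C: "assoc_algebra K C" and f: "f \<in> linear_maps K A C" and g: "g \<in> linear_maps K B C"
    and x: "x \<in> carrier C" and t: "t \<in> carrier TA"
    and comm: "\<And>a. a \<in> carrier A \<Longrightarrow> x \<otimes>\<^bsub>C\<^esub> f a = f a \<otimes>\<^bsub>C\<^esub> x"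
      "\<And>b. b \<in> carrier B \<Longrightarrow> x \<otimes>\<^bsub>C\<^esub> g b = g b \<otimes>\<^bsub>C\<^esub> x"
  shows "x \<otimes>\<^bsub>C\<^esub> tensor_lift C f g t = tensor_lift C f g t \<otimes>\<^bsub>C\<^esub> x"
proof -
  interpret C: assoc_algebra K C by fact
  note L = tensor_lift_linear[OF C f g]
  show ?thesis
  proof (rule tensor_eqI[OF _ _ _ _ t, where h = "\<lambda>t. x \<otimes>\<^bsub>C\<^esub> tensor_lift C f g t"])
    show "abelian_group C" by (rule C.M.abelian_group_axioms)
    show "(\<lambda>t. x \<otimes>\<^bsub>C\<^esub> tensor_lift C f g t) \<in> add_hom TA C"
      by (rule C.alg.add_hom_mult_left[OF L(1) x])
    show "(\<lambda>t. tensor_lift C f g t \<otimes>\<^bsub>C\<^esub> x) \<in> add_hom TA C"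
      by (rule C.alg.add_hom_mult_right[OF L(1) x])
    fix a b assume ab: "a \<in> carrier A" "b \<in> carrier B"
    then have fg: "f a \<in> carrier C" "g b \<in> carrier C"
      using linear_mapsD[OF f] linear_mapsD[OF g] by auto
    show "x \<otimes>\<^bsub>C\<^esub> tensor_lift C f g (pt a b) = tensor_lift C f g (pt a b) \<otimes>\<^bsub>C\<^esub> x"
      unfolding L(2)[OF ab] using ab fg x
      by (metis C.alg.m_assoc comm)
  qed
qed

text \<open>On pure tensors the product is f a g b f c g d, and multiplicativity amounts to
  exchanging the two inner factors; this is where commuting images enter.\<close>

lemma tensor_lift_hom:
  assumes C: "assoc_algebra K C" and f: "f \<in> algebra_homs K A C" and g: "g \<in> algebra_homs K B C"
    and comm: "commuting_maps C (carrier A) (carrier B) f g"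
  shows "tensor_lift C f g \<in> algebra_homs K TA C"
proof -
  interpret C: assoc_algebra K C by fact
  note L = tensor_lift_linear[OF C algebra_homs_linear[OF f] algebra_homs_linear[OF g]]
  note fg = algebra_homsD[OF f] algebra_homsD[OF g]
  note cl = add_homD(1)[OF L(1)] and distr = add_homD(2)[OF L(1)]
  let ?L = "tensor_lift C f g"
  have ab: "abelian_group C" by (rule C.M.abelian_group_axioms)
  show ?thesis
  proof (rule algebra_homsI)
    show "?L \<one>\<^bsub>TA\<^esub> = \<one>\<^bsub>C\<^esub>"
      using L(2)[of "\<one>\<^bsub>A\<^esub>" "\<one>\<^bsub>B\<^esub>"] by (simp add: tensor_algebra_simps(4) fg)
    show "?L (k \<odot>\<^bsub>TA\<^esub> t) = k \<odot>\<^bsub>C\<^esub> ?L t" if k: "k \<in> carrier K" and t: "t \<in> carrier TA" for k t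
      by (rule tensor_eqI[OF ab _ _ _ t, where h = "\<lambda>t. ?L (k \<odot>\<^bsub>TA\<^esub> t)"])
        (use k in \<open>auto intro!: add_homI simp: cl distr smult_tensor(2) L(2) fg C.smult_mult_left
          C.smult_r_distr TA.smult_r_distr\<close>)
    fix s t assume st: "s \<in> carrier TA" "t \<in> carrier TA"
    show "?L (s \<otimes>\<^bsub>TA\<^esub> t) = ?L s \<otimes>\<^bsub>C\<^esub> ?L t"
    proof (rule tensor_eqI[OF ab _ _ _ st(1), where h = "\<lambda>s. ?L (s \<otimes>\<^bsub>TA\<^esub> t)"])
      fix a b assume ab': "a \<in> carrier A" "b \<in> carrier B"
      show "?L (pt a b \<otimes>\<^bsub>TA\<^esub> t) = ?L (pt a b) \<otimes>\<^bsub>C\<^esub> ?L t"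
      proof (rule tensor_eqI[OF ab _ _ _ st(2), where h = "\<lambda>t. ?L (pt a b \<otimes>\<^bsub>TA\<^esub> t)"])
        fix c d assume cd: "c \<in> carrier A" "d \<in> carrier B"
        show "?L (pt a b \<otimes>\<^bsub>TA\<^esub> pt c d) = ?L (pt a b) \<otimes>\<^bsub>C\<^esub> ?L (pt c d)"
          using ab' cd commuting_mapsD[OF comm cd(1) ab'(2)]
          by (simp add: mult_pure L(2) fg C.alg.mult_four_swap)
      qed (use ab' in \<open>auto intro!: add_homI simp: cl distr TA.alg.r_distr C.alg.r_distr\<close>)
    qed (use st in \<open>auto intro!: add_homI simp: cl distr TA.alg.l_distr C.alg.l_distr\<close>)
  qed (simp_all add: cl distr)
qed

text \<open>Transports a leg expression along an algebra homomorphism. Multiplicativity is used for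
  \<Phi> alone, so \<open>f\<close> and \<open>g\<close> may be merely linear.\<close>

lemma tensor_lift_compose:
  assumes C: "assoc_algebra K C" and D: "assoc_algebra K D"
    and f: "f \<in> linear_maps K A C" and g: "g \<in> linear_maps K B C"
    and \<Phi>: "\<Phi> \<in> algebra_homs K C D" and t: "t \<in> carrier TA"
    and fg': "\<And>a. a \<in> carrier A \<Longrightarrow> \<Phi> (f a) = f' a" "\<And>b. b \<in> carrier B \<Longrightarrow> \<Phi> (g b) = g' b"
  shows "\<Phi> (tensor_lift C f g t) = tensor_lift D f' g' t"
proof (rule tensor_lift_unique[OF D _ t, where h = "\<lambda>t. \<Phi> (tensor_lift C f g t)"])
  note L = tensor_lift_linear[OF C f g]
  show "(\<lambda>t. \<Phi> (tensor_lift C f g t)) \<in> add_hom TA D"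
    by (rule add_hom_compose[OF L(1) algebra_homs_add_hom[OF \<Phi>]])
  show "\<Phi> (tensor_lift C f g (pt a b)) = f' a \<otimes>\<^bsub>D\<^esub> g' b" if "a \<in> carrier A" "b \<in> carrier B" for a b
    using that linear_mapsD[OF f] linear_mapsD[OF g]
    by (simp add: L(2) algebra_homsD[OF \<Phi>] fg')
qed

lemma pure_left_hom: "(\<lambda>a. pt a \<one>\<^bsub>B\<^esub>) \<in> algebra_homs K A TA"
  by (rule algebra_homsI) (auto simp: mult_pure pure_add_left smult_tensor(2) tensor_algebra_simps(4))

lemma pure_right_hom: "(\<lambda>b. pt \<one>\<^bsub>A\<^esub> b) \<in> algebra_homs K B TA"
  by (rule algebra_homsI)
    (auto simp: mult_pure pure_add_right smult_tensor(2) pure_balance tensor_algebra_simps(4))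

lemma tensor_map_hom:
  assumes "algebra_product K C D" and f: "f \<in> linear_maps K A C" and g: "g \<in> linear_maps K B D"
  shows "tensor_map K C D f g \<in> add_hom TA (tensor_algebra K C D)"
    and "a \<in> carrier A \<Longrightarrow> b \<in> carrier B \<Longrightarrow> tensor_map K C D f g (pt a b) = pure_tensor K C D (f a) (g b)"
proof -
  interpret CD: algebra_product K C D by fact
  note fg = linear_mapsD[OF f] linear_mapsD[OF g]
  have G: "carrier CD.T = carrier CD.TA" "monoid.mult CD.T = ring.add CD.TA"
    by (simp_all add: tensor_algebra_def)
  have *: "tensor_map K C D f g \<in> add_hom TA CD.TA \<and>
    (\<forall>a\<in>carrier A. \<forall>b\<in>carrier B. tensor_map K C D f g (pt a b) = CD.pt (f a) (g b))"
    unfolding tensor_map_def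
    using CD.comm_group_tensor_group G
    by (intro conjI ballI tensor_sum_tensor_group[where C = CD.TA])
      (auto simp: fg CD.pure_add_left CD.pure_add_right CD.pure_balance)
  then show "tensor_map K C D f g \<in> add_hom TA (tensor_algebra K C D)"
    and "a \<in> carrier A \<Longrightarrow> b \<in> carrier B \<Longrightarrow> tensor_map K C D f g (pt a b) = pure_tensor K C D (f a) (g b)"
    by auto
qed

text \<open>Multiplicativity comes from recognising f \<otimes> g as the lift of \<open>f\<close>
  and \<open>g\<close> followed by the two factor embeddings of the target, whose images
  commute.\<close>

lemma tensor_map_algebra_hom:
  assumes CD: "algebra_product K C D" and f: "f \<in> algebra_homs K A C" and g: "g \<in> algebra_homs K B D"
  shows "tensor_map K C D f g \<in> algebra_homs K TA (tensor_algebra K C D)"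
proof -
  interpret CD: algebra_product K C D by fact
  note TM = tensor_map_hom[OF CD algebra_homs_linear[OF f] algebra_homs_linear[OF g]]
  note fg = algebra_homsD[OF f] algebra_homsD[OF g]
  have f': "(\<lambda>a. CD.pt (f a) \<one>\<^bsub>D\<^esub>) \<in> algebra_homs K A CD.TA"
    by (rule algebra_homs_compose[OF f CD.pure_left_hom])
  have g': "(\<lambda>b. CD.pt \<one>\<^bsub>C\<^esub> (g b)) \<in> algebra_homs K B CD.TA"
    by (rule algebra_homs_compose[OF g CD.pure_right_hom])
  have "tensor_lift CD.TA (\<lambda>a. CD.pt (f a) \<one>\<^bsub>D\<^esub>) (\<lambda>b. CD.pt \<one>\<^bsub>C\<^esub> (g b)) \<in> algebra_homs K TA CD.TA"
    by (rule tensor_lift_hom[OF CD.TA.assoc_algebra_axioms f' g'])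
      (simp add: commuting_maps_def CD.mult_pure fg)
  moreover have "tensor_map K C D f g t
      = tensor_lift CD.TA (\<lambda>a. CD.pt (f a) \<one>\<^bsub>D\<^esub>) (\<lambda>b. CD.pt \<one>\<^bsub>C\<^esub> (g b)) t" if "t \<in> carrier TA" for t
    by (rule tensor_lift_unique[OF CD.TA.assoc_algebra_axioms TM(1) that])
      (simp add: TM(2) CD.mult_pure fg)
  ultimately show ?thesis
    by (auto simp: algebra_homs_def ring_hom_def)
qed

end

text \<open>Meant for leg expressions on disjoint pairs of slots. The commutation of one element
  with a lift is applied three times: for each leg of the second lift, and then for the whole of
  it.\<close>

lemma (in algebra_product) tensor_lift_lift_commute:
  assumes C: "assoc_algebra K C"
    and f: "f \<in> linear_maps K A C" "f' \<in> linear_maps K A C"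
    and g: "g \<in> linear_maps K B C" "g' \<in> linear_maps K B C"
    and comm: "commuting_maps C (carrier A) (carrier A) f f'" "commuting_maps C (carrier A) (carrier B) f g'"
      "commuting_maps C (carrier B) (carrier A) g f'" "commuting_maps C (carrier B) (carrier B) g g'"
    and st: "s \<in> carrier TA" "t \<in> carrier TA"
  shows "tensor_lift C f g s \<otimes>\<^bsub>C\<^esub> tensor_lift C f' g' t = tensor_lift C f' g' t \<otimes>\<^bsub>C\<^esub> tensor_lift C f g s"
proof (rule tensor_lift_commute[OF C f(2) g(2) _ st(2)])
  note cm = comm[unfolded commuting_maps_def, rule_format]
  show "tensor_lift C f g s \<in> carrier C"
    by (rule add_homD(1)[OF tensor_lift_linear(1)[OF C f(1) g(1)] st(1)])
  show "tensor_lift C f g s \<otimes>\<^bsub>C\<^esub> f' a = f' a \<otimes>\<^bsub>C\<^esub> tensor_lift C f g s" if "a \<in> carrier A" for a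
    by (rule tensor_lift_commute[OF C f(1) g(1) _ st(1), symmetric])
      (use that cm linear_mapsD(1)[OF f(2)] in auto)
  show "tensor_lift C f g s \<otimes>\<^bsub>C\<^esub> g' b = g' b \<otimes>\<^bsub>C\<^esub> tensor_lift C f g s" if "b \<in> carrier B" for b
    by (rule tensor_lift_commute[OF C f(1) g(1) _ st(1), symmetric])
      (use that cm linear_mapsD(1)[OF g(2)] in auto)
qed

text \<open>The maps \<open>D \<otimes> id\<close> and \<open>id \<otimes> U\<close> from \<open>H \<otimes> H\<close> to \<open>H \<otimes> op H\<close> are not multiplicative, so their values on
  products of four tensors are determined by comparing additive maps in four arguments.\<close>

definition quad_additive :: "('a, 'm) ring_scheme \<Rightarrow> ('b, 'n) ring_scheme \<Rightarrow> ('a \<Rightarrow> 'a \<Rightarrow> 'a \<Rightarrow> 'a \<Rightarrow> 'b) \<Rightarrow> bool" where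
  "quad_additive A C M \<longleftrightarrow> (\<forall>x\<in>carrier A. \<forall>y\<in>carrier A. \<forall>z\<in>carrier A.
    (\<lambda>s. M s x y z) \<in> add_hom A C \<and> (\<lambda>s. M x s y z) \<in> add_hom A C \<and>
    (\<lambda>s. M x y s z) \<in> add_hom A C \<and> (\<lambda>s. M x y z s) \<in> add_hom A C)"

lemma quad_additiveD:
  assumes "quad_additive A C M" "x \<in> carrier A" "y \<in> carrier A" "z \<in> carrier A"
  shows "(\<lambda>s. M s x y z) \<in> add_hom A C" "(\<lambda>s. M x s y z) \<in> add_hom A C"
    "(\<lambda>s. M x y s z) \<in> add_hom A C" "(\<lambda>s. M x y z s) \<in> add_hom A C"
  using assms by (auto simp: quad_additive_def)

lemma quad_additive_compose:
  "quad_additive A B M \<Longrightarrow> h \<in> add_hom B C \<Longrightarrow> quad_additive A C (\<lambda>s t u v. h (M s t u v))"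
  by (auto simp: quad_additive_def intro!: add_hom_compose[where B = B and g = h])

text \<open>The second argument order, third and fourth before first and second, is the one in which
  the four factors of \<alpha> and of its inverse reappear after the passage to the opposite
  algebra.\<close>

lemma (in ring) quad_additive_product:
  assumes "f1 \<in> add_hom A R" "f2 \<in> add_hom A R" "f3 \<in> add_hom A R" "f4 \<in> add_hom A R"
  shows "quad_additive A R (\<lambda>s t u v. f1 s \<otimes> f2 t \<otimes> f3 u \<otimes> f4 v)"
    and "quad_additive A R (\<lambda>s t u v. f1 u \<otimes> f2 v \<otimes> f3 s \<otimes> f4 t)"
  unfolding quad_additive_def
  using assms by (auto intro!: add_hom_mult_left add_hom_mult_right dest: add_homD(1))

lemma (in tensor_product) quad_additive_eqI:
  assumes C: "abelian_group C" and M: "quad_additive TA C M" "quad_additive TA C M'"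
    and eq: "\<And>a a' b b' c c' d d'. \<lbrakk>a \<in> carrier A; a' \<in> carrier B; b \<in> carrier A; b' \<in> carrier B;
      c \<in> carrier A; c' \<in> carrier B; d \<in> carrier A; d' \<in> carrier B\<rbrakk> \<Longrightarrow>
      M (pt a a') (pt b b') (pt c c') (pt d d') = M' (pt a a') (pt b b') (pt c c') (pt d d')"
    and cl: "s \<in> carrier TA" "t \<in> carrier TA" "u \<in> carrier TA" "v \<in> carrier TA"
  shows "M s t u v = M' s t u v"
proof -
  note D = quad_additiveD[OF M(1)] quad_additiveD[OF M(2)]
  have 1: "M (pt a a') (pt b b') (pt c c') v = M' (pt a a') (pt b b') (pt c c') v"
    if "a \<in> carrier A" "a' \<in> carrier B" "b \<in> carrier A" "b' \<in> carrier B" "c \<in> carrier A" "c' \<in> carrier B"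
    for a a' b b' c c'
    by (rule tensor_eqI[OF C D(4) D(8) _ cl(4)]) (use that eq in auto)
  have 2: "M (pt a a') (pt b b') u v = M' (pt a a') (pt b b') u v"
    if "a \<in> carrier A" "a' \<in> carrier B" "b \<in> carrier A" "b' \<in> carrier B" for a a' b b'
    by (rule tensor_eqI[OF C D(3) D(7) _ cl(3)]) (use that 1 cl in auto)
  have 3: "M (pt a a') t u v = M' (pt a a') t u v" if "a \<in> carrier A" "a' \<in> carrier B" for a a'
    by (rule tensor_eqI[OF C D(2) D(6) _ cl(2)]) (use that 2 cl in auto)
  show ?thesis
    by (rule tensor_eqI[OF C D(1) D(5) _ cl(1)]) (use 3 cl in auto)
qed

section \<open>Braid relations in a monoid\<close>

context monoid
begin

lemma telescope:
  assumes "a \<otimes> a' = \<one>" "b \<otimes> b' = \<one>" "c \<otimes> c' = \<one>" "d \<otimes> d' = \<one>"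
    and "a \<in> carrier G" "b \<in> carrier G" "c \<in> carrier G" "d \<in> carrier G"
      "a' \<in> carrier G" "b' \<in> carrier G" "c' \<in> carrier G" "d' \<in> carrier G"
  shows "(a \<otimes> b \<otimes> c \<otimes> d) \<otimes> (d' \<otimes> c' \<otimes> b' \<otimes> a') = \<one>"
proof -
  have cancel: "x \<otimes> (x' \<otimes> y) = y" if "x \<otimes> x' = \<one>" "x \<in> carrier G" "x' \<in> carrier G" "y \<in> carrier G" for x x' y
    using that by (simp add: m_assoc[symmetric])
  show ?thesis
    using assms(5-) by (simp add: m_assoc assms(1) cancel[OF assms(2)] cancel[OF assms(3)] cancel[OF assms(4)])
qed

text \<open>Multiply the equation by \<open>a'\<close> on both sides. Applied repeatedly, it turns
  crossings into inverse crossings in a Yang-Baxter equation.\<close>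

lemma braid_inverse:
  assumes yb: "a \<otimes> b \<otimes> c = c \<otimes> b \<otimes> a"
    and cl: "a \<in> carrier G" "b \<in> carrier G" "c \<in> carrier G"
  shows "a' \<in> carrier G \<Longrightarrow> a \<otimes> a' = \<one> \<Longrightarrow> a' \<otimes> a = \<one> \<Longrightarrow> a' \<otimes> c \<otimes> b = b \<otimes> c \<otimes> a'"
proof -
  assume a': "a' \<in> carrier G" "a \<otimes> a' = \<one>" "a' \<otimes> a = \<one>"
  have "a' \<otimes> c \<otimes> b = a' \<otimes> (c \<otimes> b \<otimes> a) \<otimes> a'"
    using a' cl by (simp add: m_assoc)
  also have "\<dots> = (a' \<otimes> a) \<otimes> (b \<otimes> c \<otimes> a')"
    unfolding yb[symmetric] using a'(1) cl by (simp add: m_assoc)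
  finally show ?thesis using a' cl by simp
qed

text \<open>Read \<open>a\<close>, \<open>b\<close>, \<open>c\<close> as the crossings 12, 13, 23.
  Here strand 2 is doubled; the commuting pairs are crossings without a common strand.\<close>

lemma braid_fuse_outer:
  assumes yb: "a1 \<otimes> b \<otimes> c1 = c1 \<otimes> b \<otimes> a1" "a2 \<otimes> b \<otimes> c2 = c2 \<otimes> b \<otimes> a2"
    and comm: "a2 \<otimes> c1 = c1 \<otimes> a2" "a1 \<otimes> c2 = c2 \<otimes> a1"
    and cl: "a1 \<in> carrier G" "a2 \<in> carrier G" "b \<in> carrier G" "c1 \<in> carrier G" "c2 \<in> carrier G"
  shows "(a2 \<otimes> a1) \<otimes> b \<otimes> (c1 \<otimes> c2) = (c1 \<otimes> c2) \<otimes> b \<otimes> (a2 \<otimes> a1)"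
proof -
  have "(a2 \<otimes> a1) \<otimes> b \<otimes> (c1 \<otimes> c2) = a2 \<otimes> (a1 \<otimes> b \<otimes> c1) \<otimes> c2" using cl by (simp add: m_assoc)
  also have "\<dots> = (a2 \<otimes> c1) \<otimes> b \<otimes> (a1 \<otimes> c2)" unfolding yb using cl by (simp add: m_assoc)
  also have "\<dots> = c1 \<otimes> (a2 \<otimes> b \<otimes> c2) \<otimes> a1" unfolding comm using cl by (simp add: m_assoc)
  also have "\<dots> = (c1 \<otimes> c2) \<otimes> b \<otimes> (a2 \<otimes> a1)" unfolding yb using cl by (simp add: m_assoc)
  finally show ?thesis .
qed

text \<open>In the same reading, strand 3 is doubled.\<close>

lemma braid_fuse_right:
  assumes yb: "a \<otimes> b1 \<otimes> c1 = c1 \<otimes> b1 \<otimes> a" "a \<otimes> b2 \<otimes> c2 = c2 \<otimes> b2 \<otimes> a"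
    and comm: "b2 \<otimes> c1 = c1 \<otimes> b2" "b1 \<otimes> c2 = c2 \<otimes> b1"
    and cl: "a \<in> carrier G" "b1 \<in> carrier G" "b2 \<in> carrier G" "c1 \<in> carrier G" "c2 \<in> carrier G"
  shows "a \<otimes> (b1 \<otimes> b2) \<otimes> (c1 \<otimes> c2) = (c1 \<otimes> c2) \<otimes> (b1 \<otimes> b2) \<otimes> a"
proof -
  have "a \<otimes> (b1 \<otimes> b2) \<otimes> (c1 \<otimes> c2) = a \<otimes> b1 \<otimes> (b2 \<otimes> c1) \<otimes> c2" using cl by (simp add: m_assoc)
  also have "\<dots> = (a \<otimes> b1 \<otimes> c1) \<otimes> b2 \<otimes> c2" unfolding comm using cl by (simp add: m_assoc)
  also have "\<dots> = c1 \<otimes> b1 \<otimes> (a \<otimes> b2 \<otimes> c2)" unfolding yb(1) using cl by (simp add: m_assoc)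
  also have "\<dots> = c1 \<otimes> (b1 \<otimes> c2) \<otimes> b2 \<otimes> a" unfolding yb using cl by (simp add: m_assoc)
  also have "\<dots> = (c1 \<otimes> c2) \<otimes> (b1 \<otimes> b2) \<otimes> a" unfolding comm using cl by (simp add: m_assoc)
  finally show ?thesis .
qed

text \<open>In the same reading, strand 1 is doubled.\<close>

lemma braid_fuse_left:
  assumes yb: "a1 \<otimes> b1 \<otimes> c = c \<otimes> b1 \<otimes> a1" "a2 \<otimes> b2 \<otimes> c = c \<otimes> b2 \<otimes> a2"
    and comm: "a2 \<otimes> b1 = b1 \<otimes> a2" "a1 \<otimes> b2 = b2 \<otimes> a1"
    and cl: "a1 \<in> carrier G" "a2 \<in> carrier G" "b1 \<in> carrier G" "b2 \<in> carrier G" "c \<in> carrier G"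
  shows "(a1 \<otimes> a2) \<otimes> (b1 \<otimes> b2) \<otimes> c = c \<otimes> (b1 \<otimes> b2) \<otimes> (a1 \<otimes> a2)"
proof -
  have "(a1 \<otimes> a2) \<otimes> (b1 \<otimes> b2) \<otimes> c = a1 \<otimes> (a2 \<otimes> b1) \<otimes> b2 \<otimes> c" using cl by (simp add: m_assoc)
  also have "\<dots> = a1 \<otimes> b1 \<otimes> (a2 \<otimes> b2 \<otimes> c)" unfolding comm using cl by (simp add: m_assoc)
  also have "\<dots> = (a1 \<otimes> b1 \<otimes> c) \<otimes> b2 \<otimes> a2" unfolding yb(2) using cl by (simp add: m_assoc)
  also have "\<dots> = c \<otimes> b1 \<otimes> (a1 \<otimes> b2) \<otimes> a2" unfolding yb using cl by (simp add: m_assoc)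
  also have "\<dots> = c \<otimes> (b1 \<otimes> b2) \<otimes> (a1 \<otimes> a2)" unfolding comm using cl by (simp add: m_assoc)
  finally show ?thesis .
qed

text \<open>\<open>C i j k l\<close> is the crossing of the cable i, j with the cable k, l, its
  factors ordered as in \<alpha>. Starting from single strands, the second, the third and finally
  the first strand are replaced by cables of two.\<close>

lemma cabling_yang_baxter:
  fixes X :: "nat \<Rightarrow> nat \<Rightarrow> 'a"
  assumes cl: "\<And>i j. i < 6 \<Longrightarrow> j < 6 \<Longrightarrow> i \<noteq> j \<Longrightarrow> X i j \<in> carrier G"
    and comm: "\<And>i j k l. i < 6 \<Longrightarrow> j < 6 \<Longrightarrow> k < 6 \<Longrightarrow> l < 6 \<Longrightarrow> distinct [i, j, k, l] \<Longrightarrow>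
      X i j \<otimes> X k l = X k l \<otimes> X i j"
    and yb: "\<And>i j k. i < 6 \<Longrightarrow> j < 6 \<Longrightarrow> k < 6 \<Longrightarrow> distinct [i, j, k] \<Longrightarrow>
      X i j \<otimes> X i k \<otimes> X j k = X j k \<otimes> X i k \<otimes> X i j"
  defines "C \<equiv> \<lambda>i j k l. X i l \<otimes> X i k \<otimes> X j l \<otimes> X j k"
  shows "C 0 1 2 3 \<otimes> C 0 1 4 5 \<otimes> C 2 3 4 5 = C 2 3 4 5 \<otimes> C 0 1 4 5 \<otimes> C 0 1 2 3"
proof -
  \<comment> \<open>A single strand \<open>i\<close> of the first cable against both other cables:
    \<open>fuse\<close> doubles the middle strand for each strand \<open>k\<close> of the last
    cable, and the enclosing rule joins the cases 5 and 4.\<close>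
  have line: "(X i 3 \<otimes> X i 2) \<otimes> (X i 5 \<otimes> X i 4) \<otimes> ((X 2 5 \<otimes> X 3 5) \<otimes> (X 2 4 \<otimes> X 3 4))
      = ((X 2 5 \<otimes> X 3 5) \<otimes> (X 2 4 \<otimes> X 3 4)) \<otimes> (X i 5 \<otimes> X i 4) \<otimes> (X i 3 \<otimes> X i 2)"
    if i: "i < 2" for i
  proof (rule braid_fuse_right)
    have fuse: "(X i 3 \<otimes> X i 2) \<otimes> X i k \<otimes> (X 2 k \<otimes> X 3 k) = (X 2 k \<otimes> X 3 k) \<otimes> X i k \<otimes> (X i 3 \<otimes> X i 2)"
      if "3 < k" "k < 6" for k
      by (rule braid_fuse_outer) (use i that in \<open>auto intro!: cl yb comm\<close>)
    show "(X i 3 \<otimes> X i 2) \<otimes> X i 5 \<otimes> (X 2 5 \<otimes> X 3 5) = (X 2 5 \<otimes> X 3 5) \<otimes> X i 5 \<otimes> (X i 3 \<otimes> X i 2)"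
      "(X i 3 \<otimes> X i 2) \<otimes> X i 4 \<otimes> (X 2 4 \<otimes> X 3 4) = (X 2 4 \<otimes> X 3 4) \<otimes> X i 4 \<otimes> (X i 3 \<otimes> X i 2)"
      by (rule fuse; simp)+
    have pass: "X i k \<otimes> (X 2 l \<otimes> X 3 l) = (X 2 l \<otimes> X 3 l) \<otimes> X i k"
      if "3 < k" "k < 6" "3 < l" "l < 6" "k \<noteq> l" for k l
    proof -
      have "X i k \<in> carrier G" "X 2 l \<in> carrier G" "X 3 l \<in> carrier G"
        "X i k \<otimes> X 2 l = X 2 l \<otimes> X i k" "X i k \<otimes> X 3 l = X 3 l \<otimes> X i k"
        using i that by (auto intro!: cl comm)
      then show ?thesis by (metis m_assoc)
    qed
    show "X i 4 \<otimes> (X 2 5 \<otimes> X 3 5) = (X 2 5 \<otimes> X 3 5) \<otimes> X i 4"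
      "X i 5 \<otimes> (X 2 4 \<otimes> X 3 4) = (X 2 4 \<otimes> X 3 4) \<otimes> X i 5"
      by (rule pass; simp)+
  qed (use i in \<open>auto intro!: cl m_closed\<close>)
  have split: "C i j k l = (X i l \<otimes> X i k) \<otimes> (X j l \<otimes> X j k)"
    if "i < 6" "j < 6" "k < 6" "l < 6" "distinct [i, j, k, l]" for i j k l
    using that cl by (simp add: C_def m_assoc)
  \<comment> \<open>the crossing of the last two cables, regrouped by the strands of the last cable\<close>
  have C: "C 2 3 4 5 = (X 2 5 \<otimes> X 3 5) \<otimes> (X 2 4 \<otimes> X 3 4)"
    unfolding split[of 2 3 4 5, simplified]
    by (rule mult_four_swap) (auto intro!: cl comm)
  have "C 0 1 2 3 \<otimes> C 0 1 4 5 \<otimes> C 2 3 4 5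
      = ((X 0 3 \<otimes> X 0 2) \<otimes> (X 1 3 \<otimes> X 1 2)) \<otimes> ((X 0 5 \<otimes> X 0 4) \<otimes> (X 1 5 \<otimes> X 1 4))
        \<otimes> ((X 2 5 \<otimes> X 3 5) \<otimes> (X 2 4 \<otimes> X 3 4))"
    unfolding C by (simp add: split)
  also have "\<dots> = ((X 2 5 \<otimes> X 3 5) \<otimes> (X 2 4 \<otimes> X 3 4))
      \<otimes> ((X 0 5 \<otimes> X 0 4) \<otimes> (X 1 5 \<otimes> X 1 4)) \<otimes> ((X 0 3 \<otimes> X 0 2) \<otimes> (X 1 3 \<otimes> X 1 2))"
  proof (rule braid_fuse_left)
    have pass: "(X i k \<otimes> X i l) \<otimes> (X j m \<otimes> X j n) = (X j m \<otimes> X j n) \<otimes> (X i k \<otimes> X i l)"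
      if "i < 2" "j < 2" "i \<noteq> j" "distinct [k, l, m, n]" "set [k, l, m, n] \<subseteq> {2..<6}" for i j k l m n
    proof -
      have c: "X i k \<in> carrier G" "X i l \<in> carrier G" "X j m \<in> carrier G" "X j n \<in> carrier G"
        using that by (auto intro!: cl)
      have "X i k \<otimes> X j m = X j m \<otimes> X i k" "X i l \<otimes> X j m = X j m \<otimes> X i l"
        "X i k \<otimes> X j n = X j n \<otimes> X i k" "X i l \<otimes> X j n = X j n \<otimes> X i l"
        using that by (auto intro!: comm)
      then show ?thesis using c by (metis m_assoc m_closed)
    qed
    show "(X 1 3 \<otimes> X 1 2) \<otimes> (X 0 5 \<otimes> X 0 4) = (X 0 5 \<otimes> X 0 4) \<otimes> (X 1 3 \<otimes> X 1 2)"
      "(X 0 3 \<otimes> X 0 2) \<otimes> (X 1 5 \<otimes> X 1 4) = (X 1 5 \<otimes> X 1 4) \<otimes> (X 0 3 \<otimes> X 0 2)"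
      by (rule pass; simp)+
  qed (auto intro!: cl m_closed line)
  also have "\<dots> = C 2 3 4 5 \<otimes> C 0 1 4 5 \<otimes> C 0 1 2 3"
    unfolding C by (simp add: split)
  finally show ?thesis .
qed

end

section \<open>The threefold tensor power\<close>

locale algebra_square = A: assoc_algebra K A for K (structure) and A
begin

sublocale A2: algebra_product K A A
  by (intro algebra_product.intro A.assoc_algebra_axioms)

sublocale A3: algebra_product K "tensor_algebra K A A" A
  by (intro algebra_product.intro A.assoc_algebra_axioms A2.TA.assoc_algebra_axioms)

abbreviation "cube \<equiv> tensor_algebra K (tensor_algebra K A A) A"

lemma triple_closed [simp]:
  "a \<in> carrier A \<Longrightarrow> b \<in> carrier A \<Longrightarrow> c \<in> carrier A \<Longrightarrow> triple_tensor K A a b c \<in> carrier cube"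
  by (simp add: triple_tensor_def)

lemma triple_mult:
  "\<lbrakk>a \<in> carrier A; b \<in> carrier A; c \<in> carrier A; a' \<in> carrier A; b' \<in> carrier A; c' \<in> carrier A\<rbrakk> \<Longrightarrow>
    triple_tensor K A a b c \<otimes>\<^bsub>cube\<^esub> triple_tensor K A a' b' c'
      = triple_tensor K A (a \<otimes>\<^bsub>A\<^esub> a') (b \<otimes>\<^bsub>A\<^esub> b') (c \<otimes>\<^bsub>A\<^esub> c')"
  by (simp add: triple_tensor_def A2.mult_pure A3.mult_pure)

lemma triple_homs:
  "(\<lambda>a. triple_tensor K A a \<one>\<^bsub>A\<^esub> \<one>\<^bsub>A\<^esub>) \<in> algebra_homs K A cube"
  "(\<lambda>a. triple_tensor K A \<one>\<^bsub>A\<^esub> a \<one>\<^bsub>A\<^esub>) \<in> algebra_homs K A cube"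
  "(\<lambda>a. triple_tensor K A \<one>\<^bsub>A\<^esub> \<one>\<^bsub>A\<^esub> a) \<in> algebra_homs K A cube"
  unfolding triple_tensor_def tensor_algebra_simps(4)[of K A A, symmetric]
  by (rule algebra_homs_compose[OF A2.pure_left_hom A3.pure_left_hom]
      algebra_homs_compose[OF A2.pure_right_hom A3.pure_left_hom] A3.pure_right_hom)+

lemma triple_commuting:
  "commuting_maps cube (carrier A) (carrier A)
    (\<lambda>a. triple_tensor K A a \<one>\<^bsub>A\<^esub> \<one>\<^bsub>A\<^esub>) (\<lambda>a. triple_tensor K A \<one>\<^bsub>A\<^esub> a \<one>\<^bsub>A\<^esub>)"
  "commuting_maps cube (carrier A) (carrier A)
    (\<lambda>a. triple_tensor K A a \<one>\<^bsub>A\<^esub> \<one>\<^bsub>A\<^esub>) (\<lambda>a. triple_tensor K A \<one>\<^bsub>A\<^esub> \<one>\<^bsub>A\<^esub> a)"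
  "commuting_maps cube (carrier A) (carrier A)
    (\<lambda>a. triple_tensor K A \<one>\<^bsub>A\<^esub> a \<one>\<^bsub>A\<^esub>) (\<lambda>a. triple_tensor K A \<one>\<^bsub>A\<^esub> \<one>\<^bsub>A\<^esub> a)"
  by (auto simp: commuting_maps_def triple_mult)

text \<open>Brings axiom (3) into the language of lifts, where it can be transported to other
  algebras.\<close>

lemma leg_eq_lift:
  assumes t: "t \<in> carrier (tensor_algebra K A A)"
  shows "leg12 K A t = tensor_lift cube
      (\<lambda>a. triple_tensor K A a \<one>\<^bsub>A\<^esub> \<one>\<^bsub>A\<^esub>) (\<lambda>a. triple_tensor K A \<one>\<^bsub>A\<^esub> a \<one>\<^bsub>A\<^esub>) t"
    and "leg13 K A t = tensor_lift cube
      (\<lambda>a. triple_tensor K A a \<one>\<^bsub>A\<^esub> \<one>\<^bsub>A\<^esub>) (\<lambda>a. triple_tensor K A \<one>\<^bsub>A\<^esub> \<one>\<^bsub>A\<^esub> a) t"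
    and "leg23 K A t = tensor_lift cube
      (\<lambda>a. triple_tensor K A \<one>\<^bsub>A\<^esub> a \<one>\<^bsub>A\<^esub>) (\<lambda>a. triple_tensor K A \<one>\<^bsub>A\<^esub> \<one>\<^bsub>A\<^esub> a) t"
proof -
  have G: "comm_group A3.T" "carrier A3.T = carrier cube" "monoid.mult A3.T = ring.add cube"
    by (rule A3.comm_group_tensor_group, simp_all add: tensor_algebra_simps(1,3) fun_eq_iff)
  have *: "tensor_sum A3.T F t = tensor_lift cube f g t"
    if "f \<in> algebra_homs K A cube" "g \<in> algebra_homs K A cube"
      "\<And>a b. a \<in> carrier A \<Longrightarrow> b \<in> carrier A \<Longrightarrow> F a b = f a \<otimes>\<^bsub>cube\<^esub> g b" for f g F
    using A2.tensor_lift_linear[OF A3.TA.assoc_algebra_axioms that(1,2)[THEN algebra_homs_linear]] that(3)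
    by (intro A2.tensor_sum_eq[OF _ _ G t]) auto
  show "leg12 K A t = tensor_lift cube
      (\<lambda>a. triple_tensor K A a \<one>\<^bsub>A\<^esub> \<one>\<^bsub>A\<^esub>) (\<lambda>a. triple_tensor K A \<one>\<^bsub>A\<^esub> a \<one>\<^bsub>A\<^esub>) t"
    unfolding leg12_def by (rule *[OF triple_homs(1,2)]) (simp add: triple_mult)
  show "leg13 K A t = tensor_lift cube
      (\<lambda>a. triple_tensor K A a \<one>\<^bsub>A\<^esub> \<one>\<^bsub>A\<^esub>) (\<lambda>a. triple_tensor K A \<one>\<^bsub>A\<^esub> \<one>\<^bsub>A\<^esub> a) t"
    unfolding leg13_def by (rule *[OF triple_homs(1,3)]) (simp add: triple_mult)
  show "leg23 K A t = tensor_lift cube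
      (\<lambda>a. triple_tensor K A \<one>\<^bsub>A\<^esub> a \<one>\<^bsub>A\<^esub>) (\<lambda>a. triple_tensor K A \<one>\<^bsub>A\<^esub> \<one>\<^bsub>A\<^esub> a) t"
    unfolding leg23_def by (rule *[OF triple_homs(2,3)]) (simp add: triple_mult)
qed

text \<open>Universal property of the threefold tensor product: three homomorphisms with pairwise
  commuting images combine into one. The first two are lifted, and the result commutes with the
  third.\<close>

lemma cube_lift:
  assumes B: "assoc_algebra K B"
    and efg: "e \<in> algebra_homs K A B" "f \<in> algebra_homs K A B" "g \<in> algebra_homs K A B"
    and comm: "commuting_maps B (carrier A) (carrier A) e f" "commuting_maps B (carrier A) (carrier A) e g"
      "commuting_maps B (carrier A) (carrier A) f g"
  defines "\<Theta> \<equiv> tensor_lift B (tensor_lift B e f) g"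
  shows "\<Theta> \<in> algebra_homs K cube B"
    and "a \<in> carrier A \<Longrightarrow> b \<in> carrier A \<Longrightarrow> c \<in> carrier A \<Longrightarrow>
      \<Theta> (triple_tensor K A a b c) = e a \<otimes>\<^bsub>B\<^esub> f b \<otimes>\<^bsub>B\<^esub> g c"
proof -
  interpret B: assoc_algebra K B by fact
  have ef: "tensor_lift B e f \<in> algebra_homs K A2.TA B"
    by (rule A2.tensor_lift_hom[OF B efg(1,2) comm(1)])
  note lin = efg[THEN algebra_homs_linear]
  have comm': "commuting_maps B (carrier A2.TA) (carrier A) (tensor_lift B e f) g"
    unfolding commuting_maps_def
  proof (intro ballI)
    fix t c assume t: "t \<in> carrier A2.TA" and c: "c \<in> carrier A"
    show "tensor_lift B e f t \<otimes>\<^bsub>B\<^esub> g c = g c \<otimes>\<^bsub>B\<^esub> tensor_lift B e f t"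
      using A2.tensor_lift_commute[OF B lin(1,2) algebra_homsD(1)[OF efg(3) c] t] comm(2,3) c
      by (simp add: commuting_maps_def)
  qed
  show "\<Theta> \<in> algebra_homs K cube B"
    unfolding \<Theta>_def by (rule A3.tensor_lift_hom[OF B ef efg(3) comm'])
  show "\<Theta> (triple_tensor K A a b c) = e a \<otimes>\<^bsub>B\<^esub> f b \<otimes>\<^bsub>B\<^esub> g c"
    if "a \<in> carrier A" "b \<in> carrier A" "c \<in> carrier A"
    using that A3.tensor_lift_linear(2)[OF B algebra_homs_linear[OF ef] lin(3)]
      A2.tensor_lift_linear(2)[OF B lin(1,2)]
    by (simp add: \<Theta>_def triple_tensor_def)
qed

end

text \<open>The inverse is the tensor square of the inverse of \<open>f\<close>. That this inverse
  preserves the operations follows by applying \<open>f\<close> to both sides and using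
  injectivity.\<close>

lemma (in algebra_square) tensor_map_auto:
  assumes f: "f \<in> algebra_auto K A"
  shows "tensor_map K A A f f \<in> algebra_auto K A2.TA"
proof -
  let ?g = "inv_into (carrier A) f"
  have fh: "f \<in> algebra_homs K A A" and bij: "bij_betw f (carrier A) (carrier A)"
    using f by (auto simp: algebra_auto_def algebra_homs_def ring_iso_def)
  note fD = algebra_homsD[OF fh]
  have inj: "f x = f y \<Longrightarrow> x \<in> carrier A \<Longrightarrow> y \<in> carrier A \<Longrightarrow> x = y" for x y
    using bij by (auto simp: bij_betw_def inj_on_def)
  have g: "?g x \<in> carrier A" "f (?g x) = x" if "x \<in> carrier A" for x
    using bij that by (auto simp: bij_betw_def inv_into_into f_inv_into_f)
  have gf: "?g (f x) = x" if "x \<in> carrier A" for x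
    using bij that by (auto simp: bij_betw_def)
  have gh: "?g \<in> algebra_homs K A A"
  proof (rule algebra_homsI)
    show "?g (k \<odot>\<^bsub>A\<^esub> x) = k \<odot>\<^bsub>A\<^esub> ?g x" if "k \<in> carrier K" "x \<in> carrier A" for k x
      by (rule inj) (use that in \<open>simp_all add: g fD\<close>)
    show "?g \<one>\<^bsub>A\<^esub> = \<one>\<^bsub>A\<^esub>" by (rule inj) (simp_all add: g fD)
    fix x y assume "x \<in> carrier A" "y \<in> carrier A"
    then show "?g (x \<otimes>\<^bsub>A\<^esub> y) = ?g x \<otimes>\<^bsub>A\<^esub> ?g y" "?g (x \<oplus>\<^bsub>A\<^esub> y) = ?g x \<oplus>\<^bsub>A\<^esub> ?g y"
      by - (rule inj; simp add: g fD)+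
  qed (rule g)
  note P = A2.algebra_product_axioms
  note F = A2.tensor_map_hom[OF P fh[THEN algebra_homs_linear] fh[THEN algebra_homs_linear]]
    and G = A2.tensor_map_hom[OF P gh[THEN algebra_homs_linear] gh[THEN algebra_homs_linear]]
  have id: "(\<lambda>t. t) \<in> add_hom A2.TA A2.TA" by (simp add: add_hom_def)
  have FG: "tensor_map K A A f f (tensor_map K A A ?g ?g t) = t" if t: "t \<in> carrier A2.TA" for t
    by (rule A2.tensor_eqI[OF A2.abelian_group_tensor add_hom_compose[OF G(1) F(1)] id _ t])
      (simp add: F(2) G(2) g)
  have GF: "tensor_map K A A ?g ?g (tensor_map K A A f f t) = t" if t: "t \<in> carrier A2.TA" for t
    by (rule A2.tensor_eqI[OF A2.abelian_group_tensor add_hom_compose[OF F(1) G(1)] id _ t])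
      (simp add: F(2) G(2) gf fD)
  have "bij_betw (tensor_map K A A f f) (carrier A2.TA) (carrier A2.TA)"
    by (rule bij_betwI[where g = "tensor_map K A A ?g ?g"])
      (auto simp: FG GF add_homD(1)[OF F(1)] add_homD(1)[OF G(1)])
  then show ?thesis
    using A2.tensor_map_algebra_hom[OF P fh fh]
    by (simp add: algebra_auto_def algebra_homs_def ring_iso_def)
qed

section \<open>The tensor square of an oriented quantum algebra\<close>

context oriented_quantum_algebra
begin

interpretation SQ: algebra_square K H
  by (intro algebra_square.intro assoc_algebra_axioms)

interpretation opH: assoc_algebra K "op_algebra H"
  by (intro assoc_algebra_op assoc_algebra_axioms)

interpretation HO: algebra_product K H "op_algebra H"
  by (intro algebra_product.intro assoc_algebra_axioms opH.assoc_algebra_axioms)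

section \<open>The axioms transported to an arbitrary target algebra\<close>

abbreviation "HH \<equiv> tensor_algebra K H H"
abbreviation "R \<equiv> inv\<^bsub>HH\<^esub> r"

lemma r_closed [simp]: "r \<in> carrier HH" and R_closed [simp]: "R \<in> carrier HH"
  using r_unit by auto

lemma D_hom: "D \<in> algebra_homs K H H" and U_hom: "U \<in> algebra_homs K H H"
  using D_auto U_auto by (auto simp: algebra_auto_def algebra_homs_def ring_iso_def)

text \<open>Axiom (3) is the case of the three embeddings into the cube; the general equation is its
  image under \<Theta>.\<close>

lemma yang_baxter:
  assumes B: "assoc_algebra K B"
    and efg: "e \<in> algebra_homs K H B" "f \<in> algebra_homs K H B" "g \<in> algebra_homs K H B"
    and comm: "commuting_maps B (carrier H) (carrier H) e f" "commuting_maps B (carrier H) (carrier H) e g"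
      "commuting_maps B (carrier H) (carrier H) f g"
  shows "tensor_lift B e f r \<otimes>\<^bsub>B\<^esub> tensor_lift B e g r \<otimes>\<^bsub>B\<^esub> tensor_lift B f g r
    = tensor_lift B f g r \<otimes>\<^bsub>B\<^esub> tensor_lift B e g r \<otimes>\<^bsub>B\<^esub> tensor_lift B e f r"
proof -
  interpret B: assoc_algebra K B by fact
  define \<Theta> where "\<Theta> = tensor_lift B (tensor_lift B e f) g"
  note \<Theta> = SQ.cube_lift[OF assms, folded \<Theta>_def]
  note efg' = algebra_homsD[OF efg(1)] algebra_homsD[OF efg(2)] algebra_homsD[OF efg(3)]
  have legs: "\<Theta> (leg12 K H r) = tensor_lift B e f r" "\<Theta> (leg13 K H r) = tensor_lift B e g r"
    "\<Theta> (leg23 K H r) = tensor_lift B f g r"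
    unfolding SQ.leg_eq_lift[OF r_closed]
    by (rule SQ.A2.tensor_lift_compose[OF SQ.A3.TA.assoc_algebra_axioms B _ _ \<Theta>(1) r_closed];
      simp add: SQ.triple_homs[THEN algebra_homs_linear] \<Theta>(2) efg')+
  have cl: "leg12 K H r \<in> carrier SQ.cube" "leg13 K H r \<in> carrier SQ.cube" "leg23 K H r \<in> carrier SQ.cube"
    unfolding SQ.leg_eq_lift[OF r_closed]
    by (rule add_homD(1)[OF SQ.A2.tensor_lift_linear(1)[OF SQ.A3.TA.assoc_algebra_axioms]];
      simp add: SQ.triple_homs[THEN algebra_homs_linear])+
  from qa3 have "\<Theta> (leg12 K H r \<otimes>\<^bsub>SQ.cube\<^esub> leg13 K H r \<otimes>\<^bsub>SQ.cube\<^esub> leg23 K H r)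
      = \<Theta> (leg23 K H r \<otimes>\<^bsub>SQ.cube\<^esub> leg13 K H r \<otimes>\<^bsub>SQ.cube\<^esub> leg12 K H r)"
    by (simp add: tensor_cube_def)
  then show ?thesis
    using cl by (simp add: algebra_homsD(2)[OF \<Theta>(1)] legs)
qed

lemma lift_inverse:
  assumes B: "assoc_algebra K B" and fg: "f \<in> algebra_homs K H B" "g \<in> algebra_homs K H B"
    and comm: "commuting_maps B (carrier H) (carrier H) f g"
  shows "tensor_lift B f g r \<otimes>\<^bsub>B\<^esub> tensor_lift B f g R = \<one>\<^bsub>B\<^esub>"
    and "tensor_lift B f g R \<otimes>\<^bsub>B\<^esub> tensor_lift B f g r = \<one>\<^bsub>B\<^esub>"
  using algebra_homsD(2,4)[OF SQ.A2.tensor_lift_hom[OF B fg comm]] r_unit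
  by (metis R_closed r_closed SQ.A2.TA.alg.Units_r_inv, metis R_closed r_closed SQ.A2.TA.alg.Units_l_inv)

text \<open>\<phi> \<otimes> \<phi> is an algebra homomorphism fixing \<open>r\<close>, so it sends
  \<open>R\<close> to an inverse of \<open>r\<close>, and inverses are unique.\<close>

lemma tensor_map_inverse:
  assumes \<phi>: "\<phi> \<in> algebra_homs K H H" and inv: "tensor_map K H H \<phi> \<phi> r = r"
  shows "tensor_map K H H \<phi> \<phi> R = R"
proof -
  note TM = SQ.A2.tensor_map_algebra_hom[OF SQ.A2.algebra_product_axioms \<phi> \<phi>]
  have "r \<otimes>\<^bsub>HH\<^esub> tensor_map K H H \<phi> \<phi> R = \<one>\<^bsub>HH\<^esub>"
    using algebra_homsD(2,4)[OF TM] inv r_unit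
    by (metis R_closed r_closed SQ.A2.TA.alg.Units_r_inv)
  then show ?thesis
    using r_unit algebra_homsD(1)[OF TM R_closed]
    by (metis SQ.A2.TA.alg.Units_l_inv SQ.A2.TA.alg.inv_unique R_closed r_closed)
qed

text \<open>Allows an automorphism that leaves \<open>t\<close> invariant to be inserted into, or
  removed from, both legs at once.\<close>

lemma lift_precompose:
  assumes B: "assoc_algebra K B" and fg: "f \<in> linear_maps K H B" "g \<in> linear_maps K H B"
    and \<phi>: "\<phi> \<in> algebra_homs K H H" and t: "t \<in> carrier HH" "tensor_map K H H \<phi> \<phi> t = t"
  shows "tensor_lift B (\<lambda>x. f (\<phi> x)) (\<lambda>x. g (\<phi> x)) t = tensor_lift B f g t"
proof -
  note TM = SQ.A2.tensor_map_hom[OF SQ.A2.algebra_product_axioms algebra_homs_linear[OF \<phi>] algebra_homs_linear[OF \<phi>]]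
  note L = SQ.A2.tensor_lift_linear[OF B fg]
  have "tensor_lift B f g (tensor_map K H H \<phi> \<phi> t) = tensor_lift B (\<lambda>x. f (\<phi> x)) (\<lambda>x. g (\<phi> x)) t"
    by (rule SQ.A2.tensor_lift_unique[OF B add_hom_compose[OF TM(1) L(1)] t(1)])
      (simp add: TM(2) L(2) algebra_homsD(1)[OF \<phi>])
  then show ?thesis by (simp add: t)
qed

text \<open>A homomorphism \<open>f\<close> and an antihomomorphism \<open>g\<close> with commuting
  images lift to an algebra homomorphism on the product of \<open>H\<close> with
  \<open>op_algebra H\<close>. Applied to the two identities of axiom (1), it gives the
  claims.\<close>

lemma lift_op_inverse:
  assumes B: "assoc_algebra K B" and f: "f \<in> algebra_homs K H B" and g: "g \<in> algebra_homs K (op_algebra H) B"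
    and comm: "commuting_maps B (carrier H) (carrier H) f g"
  shows "tensor_lift B (\<lambda>x. f (D x)) g R \<otimes>\<^bsub>B\<^esub> tensor_lift B f (\<lambda>x. g (U x)) r = \<one>\<^bsub>B\<^esub>"
    and "tensor_lift B f (\<lambda>x. g (U x)) r \<otimes>\<^bsub>B\<^esub> tensor_lift B (\<lambda>x. f (D x)) g R = \<one>\<^bsub>B\<^esub>"
proof -
  have \<Theta>: "tensor_lift B f g \<in> algebra_homs K HO.TA B"
    by (rule HO.tensor_lift_hom[OF B f g]) (use comm in simp)
  note lin = algebra_homs_linear[OF D_hom] algebra_homs_linear[OF U_hom]
  have fg: "f \<in> linear_maps K H B" "g \<in> linear_maps K H B"
    using algebra_homs_linear[OF f] algebra_homs_linear[OF g] by simp_all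
  note L = SQ.A2.tensor_lift_linear[OF B fg]
  \<comment> \<open>The maps of axiom (1) are viewed as additive endomaps of \<open>HH\<close>,
    since passing to the opposite factor changes neither carrier nor addition; products enter only
    through \<Theta>.\<close>
  have DI: "tensor_map K H (op_algebra H) D id \<in> add_hom HH HH"
    "\<And>a b. a \<in> carrier H \<Longrightarrow> b \<in> carrier H \<Longrightarrow>
      tensor_map K H (op_algebra H) D id (pure_tensor K H H a b) = pure_tensor K H H (D a) b"
    using SQ.A2.tensor_map_hom[OF HO.algebra_product_axioms, of D id] lin
    by (simp_all add: add_hom_def id_linear)
  have IU: "tensor_map K H (op_algebra H) id U \<in> add_hom HH HH"
    "\<And>a b. a \<in> carrier H \<Longrightarrow> b \<in> carrier H \<Longrightarrow>
      tensor_map K H (op_algebra H) id U (pure_tensor K H H a b) = pure_tensor K H H a (U b)"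
    using SQ.A2.tensor_map_hom[OF HO.algebra_product_axioms, of id U] lin
    by (simp_all add: add_hom_def id_linear)
  have 1: "tensor_lift B f g (tensor_map K H (op_algebra H) D id R) = tensor_lift B (\<lambda>x. f (D x)) g R"
    by (rule SQ.A2.tensor_lift_unique[OF B add_hom_compose[OF DI(1) L(1)] R_closed])
      (simp add: DI(2) L(2) algebra_homsD(1)[OF D_hom])
  have 2: "tensor_lift B f g (tensor_map K H (op_algebra H) id U r) = tensor_lift B f (\<lambda>x. g (U x)) r"
    by (rule SQ.A2.tensor_lift_unique[OF B add_hom_compose[OF IU(1) L(1)] r_closed])
      (simp add: IU(2) L(2) algebra_homsD(1)[OF U_hom])
  have cl: "tensor_map K H (op_algebra H) D id R \<in> carrier HO.TA" "tensor_map K H (op_algebra H) id U r \<in> carrier HO.TA"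
    using add_homD(1)[OF DI(1) R_closed] add_homD(1)[OF IU(1) r_closed] by simp_all
  show "tensor_lift B (\<lambda>x. f (D x)) g R \<otimes>\<^bsub>B\<^esub> tensor_lift B f (\<lambda>x. g (U x)) r = \<one>\<^bsub>B\<^esub>"
    unfolding 1[symmetric] 2[symmetric] algebra_homsD(2)[OF \<Theta> cl, symmetric] qa1(1)
    by (rule algebra_homsD(4)[OF \<Theta>])
  show "tensor_lift B f (\<lambda>x. g (U x)) r \<otimes>\<^bsub>B\<^esub> tensor_lift B (\<lambda>x. f (D x)) g R = \<one>\<^bsub>B\<^esub>"
    unfolding 1[symmetric] 2[symmetric] algebra_homsD(2)[OF \<Theta> cl(2,1), symmetric] qa1(2)
    by (rule algebra_homsD(4)[OF \<Theta>])
qed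

text \<open>Obtained from \<open>lift_op_inverse\<close> in \<open>op B\<close> for the maps \<open>g \<circ> U\<close> and \<open>f \<circ> D\<close>, since \<open>r\<close> is
  invariant under \<open>U \<otimes> U\<close> and its inverse under \<open>D \<otimes> D\<close>.\<close>

lemma lift_op_inverse':
  assumes B: "assoc_algebra K B" and f: "f \<in> algebra_homs K H B" and g: "g \<in> algebra_homs K (op_algebra H) B"
    and comm: "commuting_maps B (carrier H) (carrier H) f g"
  shows "tensor_lift B g (\<lambda>x. f (D x)) r \<otimes>\<^bsub>B\<^esub> tensor_lift B (\<lambda>x. g (U x)) f R = \<one>\<^bsub>B\<^esub>"
    and "tensor_lift B (\<lambda>x. g (U x)) f R \<otimes>\<^bsub>B\<^esub> tensor_lift B g (\<lambda>x. f (D x)) r = \<one>\<^bsub>B\<^esub>"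
proof -
  interpret B: assoc_algebra K B by fact
  let ?f = "\<lambda>x. g (U x)" and ?g = "\<lambda>x. f (D x)"
  have B': "assoc_algebra K (op_algebra B)" by (rule assoc_algebra_op[OF B])
  have "U \<in> algebra_homs K (op_algebra H) (op_algebra H)" "D \<in> algebra_homs K (op_algebra H) (op_algebra H)"
    using U_hom D_hom by (simp_all only: algebra_homs_op(1))
  then have f': "?f \<in> algebra_homs K H (op_algebra B)" and g': "?g \<in> algebra_homs K (op_algebra H) (op_algebra B)"
    using algebra_homs_compose[OF _ g, of U "op_algebra H"] algebra_homs_compose[OF D_hom f] by simp_all
  have c: "f x \<otimes>\<^bsub>B\<^esub> g y = g y \<otimes>\<^bsub>B\<^esub> f x" if "x \<in> carrier H" "y \<in> carrier H" for x y
    using comm that by (simp add: commuting_maps_def)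
  note DU = algebra_homsD(1)[OF D_hom] algebra_homsD(1)[OF U_hom]
  have comm': "commuting_maps (op_algebra B) (carrier H) (carrier H) ?f ?g"
    by (simp add: commuting_maps_def c DU)
  note * = lift_op_inverse[OF B' f' g' comm']
  have fg: "f \<in> linear_maps K H B" "g \<in> linear_maps K H B" "?f \<in> linear_maps K H B" "?g \<in> linear_maps K H B"
    using algebra_homs_linear[OF f] algebra_homs_linear[OF g] algebra_homs_linear[OF f'] algebra_homs_linear[OF g']
    by simp_all
  have DU_lin: "D \<in> linear_maps K H H" "U \<in> linear_maps K H H"
    using D_hom U_hom by (simp_all add: algebra_homs_linear)
  \<comment> \<open>Passing to the opposite algebra swaps the two factors of each summand, and these
    commute.\<close>
  have op: "tensor_lift (op_algebra B) h k t = tensor_lift B h k t"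
    if "h \<in> linear_maps K H B" "k \<in> linear_maps K H B" "t \<in> carrier HH"
      "commuting_maps B (carrier H) (carrier H) h k" for h k t
    using SQ.A2.tensor_lift_linear[OF B' , of h k] that
    by (intro SQ.A2.tensor_lift_unique[OF B]) (auto simp: commuting_maps_def)
  have 1: "tensor_lift (op_algebra B) (\<lambda>x. ?f (D x)) ?g R = tensor_lift B ?f f R"
  proof -
    have "tensor_lift (op_algebra B) (\<lambda>x. ?f (D x)) ?g R = tensor_lift B (\<lambda>x. ?f (D x)) ?g R"
      by (rule op[OF linear_maps_compose[OF DU_lin(1) fg(3)] fg(4) R_closed]) (simp add: commuting_maps_def c DU)
    also have "\<dots> = tensor_lift B ?f f R"
      by (rule lift_precompose[OF B fg(3) fg(1) D_hom R_closed])
        (rule tensor_map_inverse[OF D_hom qa2(1)])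
    finally show ?thesis .
  qed
  have 2: "tensor_lift (op_algebra B) ?f (\<lambda>x. ?g (U x)) r = tensor_lift B g ?g r"
  proof -
    have "tensor_lift (op_algebra B) ?f (\<lambda>x. ?g (U x)) r = tensor_lift B ?f (\<lambda>x. ?g (U x)) r"
      by (rule op[OF fg(3) linear_maps_compose[OF DU_lin(2) fg(4)] r_closed]) (simp add: commuting_maps_def c DU)
    also have "\<dots> = tensor_lift B g ?g r"
      by (rule lift_precompose[OF B fg(2) fg(4) U_hom r_closed qa2(2)])
    finally show ?thesis .
  qed
  show "tensor_lift B g ?g r \<otimes>\<^bsub>B\<^esub> tensor_lift B ?f f R = \<one>\<^bsub>B\<^esub>"
    using *(1) by (simp add: 1 2)
  show "tensor_lift B ?f f R \<otimes>\<^bsub>B\<^esub> tensor_lift B g ?g r = \<one>\<^bsub>B\<^esub>"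
    using *(2) by (simp add: 1 2)
qed

section \<open>The fourfold tensor product and the factors of \<alpha>\<close>

interpretation SQ2: algebra_square K "tensor_algebra K H H"
  by (intro algebra_square.intro SQ.A2.TA.assoc_algebra_axioms)

interpretation E: algebra_product K "tensor_algebra K H H" "op_algebra (tensor_algebra K H H)"
  by (intro algebra_product.intro SQ.A2.TA.assoc_algebra_axioms assoc_algebra_op)

abbreviation "H4 \<equiv> tensor_algebra K HH HH"

abbreviation tens2 (infixl "\<boxdot>" 72) where "a \<boxdot> b \<equiv> pure_tensor K H H a b"
abbreviation tens4 (infixl "\<boxtimes>" 71) where "s \<boxtimes> t \<equiv> pure_tensor K HH HH s t"

definition "slot1 x = (x \<boxdot> \<one>\<^bsub>H\<^esub>) \<boxtimes> (\<one>\<^bsub>H\<^esub> \<boxdot> \<one>\<^bsub>H\<^esub>)"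
definition "slot2 x = (\<one>\<^bsub>H\<^esub> \<boxdot> x) \<boxtimes> (\<one>\<^bsub>H\<^esub> \<boxdot> \<one>\<^bsub>H\<^esub>)"
definition "slot3 x = (\<one>\<^bsub>H\<^esub> \<boxdot> \<one>\<^bsub>H\<^esub>) \<boxtimes> (x \<boxdot> \<one>\<^bsub>H\<^esub>)"
definition "slot4 x = (\<one>\<^bsub>H\<^esub> \<boxdot> \<one>\<^bsub>H\<^esub>) \<boxtimes> (\<one>\<^bsub>H\<^esub> \<boxdot> x)"

lemmas slot_defs = slot1_def slot2_def slot3_def slot4_def

lemma slot_homs:
  "slot1 \<in> algebra_homs K H H4" "slot2 \<in> algebra_homs K H H4"
  "slot3 \<in> algebra_homs K H H4" "slot4 \<in> algebra_homs K H H4"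
  unfolding slot_defs[abs_def] tensor_algebra_simps(4)[of K H H, symmetric]
  by (rule algebra_homs_compose[OF SQ.A2.pure_left_hom SQ2.A2.pure_left_hom]
      algebra_homs_compose[OF SQ.A2.pure_right_hom SQ2.A2.pure_left_hom]
      algebra_homs_compose[OF SQ.A2.pure_left_hom SQ2.A2.pure_right_hom]
      algebra_homs_compose[OF SQ.A2.pure_right_hom SQ2.A2.pure_right_hom])+

lemmas slot_linear = slot_homs[THEN algebra_homs_linear]

lemma slot_commuting:
  "commuting_maps H4 (carrier H) (carrier H) slot1 slot3" "commuting_maps H4 (carrier H) (carrier H) slot1 slot4"
  "commuting_maps H4 (carrier H) (carrier H) slot2 slot4" "commuting_maps H4 (carrier H) (carrier H) slot3 slot2"
  by (auto simp: commuting_maps_def slot_defs SQ.A2.mult_pure SQ2.A2.mult_pure)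

text \<open>On pure tensors the slots multiply independently, so the product of the four lifts
  collects in each slot exactly the factors of the summand of \<open>alpha_tensor\<close>.\<close>

lemma alpha_factors:
  "alpha_tensor K H r = tensor_lift H4 slot1 slot4 r \<otimes>\<^bsub>H4\<^esub> tensor_lift H4 slot1 slot3 r
    \<otimes>\<^bsub>H4\<^esub> tensor_lift H4 slot2 slot4 r \<otimes>\<^bsub>H4\<^esub> tensor_lift H4 slot3 slot2 R"
proof -
  let ?M = "\<lambda>s t u v. tensor_lift H4 slot1 slot4 s \<otimes>\<^bsub>H4\<^esub> tensor_lift H4 slot1 slot3 t
    \<otimes>\<^bsub>H4\<^esub> tensor_lift H4 slot2 slot4 u \<otimes>\<^bsub>H4\<^esub> tensor_lift H4 slot3 slot2 v"
  note L = SQ.A2.tensor_lift_linear[OF SQ2.A2.TA.assoc_algebra_axioms]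
  have quad: "quad_additive HH H4 ?M"
    by (intro SQ2.A2.TA.alg.quad_additive_product L(1) slot_linear)
  have pure: "((a \<otimes>\<^bsub>H\<^esub> b) \<boxdot> (c \<otimes>\<^bsub>H\<^esub> d')) \<boxtimes> ((b' \<otimes>\<^bsub>H\<^esub> d) \<boxdot> (a' \<otimes>\<^bsub>H\<^esub> c'))
      = ?M (a \<boxdot> a') (b \<boxdot> b') (c \<boxdot> c') (d \<boxdot> d')"
    if "a \<in> carrier H" "a' \<in> carrier H" "b \<in> carrier H" "b' \<in> carrier H" "c \<in> carrier H" "c' \<in> carrier H"
      "d \<in> carrier H" "d' \<in> carrier H" for a a' b b' c c' d d'
    using that by (simp add: L(2) slot_linear slot_defs SQ.A2.mult_pure SQ2.A2.mult_pure)
  have G: "comm_group SQ2.A2.T" "carrier SQ2.A2.T = carrier H4" "monoid.mult SQ2.A2.T = ring.add H4"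
    by (rule SQ2.A2.comm_group_tensor_group, simp_all add: tensor_algebra_simps(1,3) fun_eq_iff)
  note sum = SQ.A2.tensor_sum_eq[OF _ _ G]
  show ?thesis
    unfolding alpha_tensor_def Let_def
    \<comment> \<open>Each step evaluates the outermost remaining sum as the value of
      \<open>?M\<close> in that argument, leaving the same identity with the argument replaced by a
      pure tensor.\<close>
    apply (rule sum[OF quad_additiveD(1)[OF quad] _ r_closed]; simp?)
    apply (rule sum[OF quad_additiveD(2)[OF quad] _ r_closed]; simp?)
    apply (rule sum[OF quad_additiveD(3)[OF quad] _ r_closed]; simp?)
    apply (rule sum[OF quad_additiveD(4)[OF quad] _ R_closed]; simp add: pure)
    done
qed

text \<open>Evaluates algebra homomorphisms on \<alpha> from their restrictions to the slots. It
  serves both the invariance of \<alpha> and the placement of \<alpha> in two factors of the cube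
  over \<open>HH\<close>.\<close>

lemma alpha_image:
  assumes B: "assoc_algebra K B" and \<Phi>: "\<Phi> \<in> algebra_homs K H4 B"
    and e: "\<And>x. x \<in> carrier H \<Longrightarrow> \<Phi> (slot1 x) = e1 x" "\<And>x. x \<in> carrier H \<Longrightarrow> \<Phi> (slot2 x) = e2 x"
      "\<And>x. x \<in> carrier H \<Longrightarrow> \<Phi> (slot3 x) = e3 x" "\<And>x. x \<in> carrier H \<Longrightarrow> \<Phi> (slot4 x) = e4 x"
  shows "\<Phi> (alpha_tensor K H r) = tensor_lift B e1 e4 r \<otimes>\<^bsub>B\<^esub> tensor_lift B e1 e3 r
    \<otimes>\<^bsub>B\<^esub> tensor_lift B e2 e4 r \<otimes>\<^bsub>B\<^esub> tensor_lift B e3 e2 R"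
proof -
  note cl = add_homD(1)[OF SQ.A2.tensor_lift_linear(1)[OF SQ2.A2.TA.assoc_algebra_axioms]]
  note comp = SQ.A2.tensor_lift_compose[OF SQ2.A2.TA.assoc_algebra_axioms B _ _ \<Phi>]
  have "\<Phi> (tensor_lift H4 slot1 slot4 r) = tensor_lift B e1 e4 r"
    "\<Phi> (tensor_lift H4 slot1 slot3 r) = tensor_lift B e1 e3 r"
    "\<Phi> (tensor_lift H4 slot2 slot4 r) = tensor_lift B e2 e4 r"
    "\<Phi> (tensor_lift H4 slot3 slot2 R) = tensor_lift B e3 e2 R"
    by (rule comp; simp add: slot_linear e)+
  then show ?thesis
    by (simp add: alpha_factors algebra_homsD(2)[OF \<Phi>] cl slot_linear)
qed

text \<open>The factors are inverted one by one in reverse order; the flipped inverse of the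
  crossing of 2 and 3 thereby turns back into \<open>r\<close> with legs in slots 3 and 2.\<close>

lemma alpha_inverse:
  defines "\<beta> \<equiv> tensor_lift H4 slot3 slot2 r \<otimes>\<^bsub>H4\<^esub> tensor_lift H4 slot2 slot4 R
    \<otimes>\<^bsub>H4\<^esub> tensor_lift H4 slot1 slot3 R \<otimes>\<^bsub>H4\<^esub> tensor_lift H4 slot1 slot4 R"
  shows "alpha_tensor K H r \<in> Units H4" and "inv\<^bsub>H4\<^esub> (alpha_tensor K H r) = \<beta>"
proof -
  note B = SQ2.A2.TA.assoc_algebra_axioms
  note cl = add_homD(1)[OF SQ.A2.tensor_lift_linear(1)[OF B]]
  note inv = lift_inverse[OF B slot_homs(1) slot_homs(3) slot_commuting(1)]
    lift_inverse[OF B slot_homs(1) slot_homs(4) slot_commuting(2)]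
    lift_inverse[OF B slot_homs(2) slot_homs(4) slot_commuting(3)]
    lift_inverse[OF B slot_homs(3) slot_homs(2) slot_commuting(4)]
  have 1: "alpha_tensor K H r \<otimes>\<^bsub>H4\<^esub> \<beta> = \<one>\<^bsub>H4\<^esub>"
    unfolding alpha_factors \<beta>_def by (rule SQ2.A2.TA.alg.telescope) (simp_all add: inv cl slot_linear)
  have 2: "\<beta> \<otimes>\<^bsub>H4\<^esub> alpha_tensor K H r = \<one>\<^bsub>H4\<^esub>"
    unfolding alpha_factors \<beta>_def by (rule SQ2.A2.TA.alg.telescope) (simp_all add: inv cl slot_linear)
  have c: "alpha_tensor K H r \<in> carrier H4" "\<beta> \<in> carrier H4"
    by (simp_all add: alpha_factors \<beta>_def cl slot_linear)
  show "alpha_tensor K H r \<in> Units H4" using c 1 2 by (auto simp: Units_def)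
  show "inv\<^bsub>H4\<^esub> (alpha_tensor K H r) = \<beta>" using c 1 2 by (metis SQ2.A2.TA.alg.inv_char)
qed

section \<open>Axiom (2) for \<alpha>\<close>

abbreviation "DD \<equiv> tensor_map K H H D D"
abbreviation "UU \<equiv> tensor_map K H H U U"

lemma DD_hom: "DD \<in> algebra_homs K HH HH" and UU_hom: "UU \<in> algebra_homs K HH HH"
  by (rule SQ.A2.tensor_map_algebra_hom[OF SQ.A2.algebra_product_axioms] D_hom U_hom)+

lemma DD_pure: "a \<in> carrier H \<Longrightarrow> b \<in> carrier H \<Longrightarrow> DD (a \<boxdot> b) = D a \<boxdot> D b"
  and UU_pure: "a \<in> carrier H \<Longrightarrow> b \<in> carrier H \<Longrightarrow> UU (a \<boxdot> b) = U a \<boxdot> U b"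
  by (rule SQ.A2.tensor_map_hom(2)[OF SQ.A2.algebra_product_axioms];
      simp add: algebra_homs_linear[OF D_hom] algebra_homs_linear[OF U_hom])+

text \<open>The tensor power of \<phi> acts in each slot as \<phi>, hence on both legs of every
  factor, where it is absorbed by the invariance of \<open>r\<close> and \<open>R\<close>.\<close>

lemma alpha_invariant:
  assumes \<phi>: "\<phi> \<in> algebra_homs K H H" and inv: "tensor_map K H H \<phi> \<phi> r = r"
  defines "\<Phi> \<equiv> tensor_map K H H \<phi> \<phi>"
  shows "tensor_map K HH HH \<Phi> \<Phi> (alpha_tensor K H r) = alpha_tensor K H r"
proof -
  note P = SQ.A2.algebra_product_axioms and P2 = SQ2.A2.algebra_product_axioms
  note B = SQ2.A2.TA.assoc_algebra_axioms
  have \<Phi>: "\<Phi> \<in> algebra_homs K HH HH"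
    unfolding \<Phi>_def by (rule SQ.A2.tensor_map_algebra_hom[OF P \<phi> \<phi>])
  note \<phi>D = algebra_homsD[OF \<phi>]
  have pure: "\<Phi> (a \<boxdot> b) = \<phi> a \<boxdot> \<phi> b" if "a \<in> carrier H" "b \<in> carrier H" for a b
    unfolding \<Phi>_def using that
    by (intro SQ.A2.tensor_map_hom(2)[OF P] algebra_homs_linear[OF \<phi>])
  have pure2: "tensor_map K HH HH \<Phi> \<Phi> (s \<boxtimes> t) = \<Phi> s \<boxtimes> \<Phi> t" if "s \<in> carrier HH" "t \<in> carrier HH" for s t
    using that by (intro SQ2.A2.tensor_map_hom(2)[OF P2] algebra_homs_linear[OF \<Phi>])
  have invR: "tensor_map K H H \<phi> \<phi> R = R" by (rule tensor_map_inverse[OF \<phi> inv])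
  have "tensor_map K HH HH \<Phi> \<Phi> (alpha_tensor K H r)
      = tensor_lift H4 (\<lambda>x. slot1 (\<phi> x)) (\<lambda>x. slot4 (\<phi> x)) r \<otimes>\<^bsub>H4\<^esub> tensor_lift H4 (\<lambda>x. slot1 (\<phi> x)) (\<lambda>x. slot3 (\<phi> x)) r
    \<otimes>\<^bsub>H4\<^esub> tensor_lift H4 (\<lambda>x. slot2 (\<phi> x)) (\<lambda>x. slot4 (\<phi> x)) r \<otimes>\<^bsub>H4\<^esub> tensor_lift H4 (\<lambda>x. slot3 (\<phi> x)) (\<lambda>x. slot2 (\<phi> x)) R"
    by (rule alpha_image[OF B SQ2.A2.tensor_map_algebra_hom[OF P2 \<Phi> \<Phi>]])
      (simp_all add: slot_defs pure pure2 \<phi>D)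
  also have "\<dots> = alpha_tensor K H r"
    by (simp add: alpha_factors lift_precompose[OF B slot_linear(1) slot_linear(4) \<phi> r_closed inv]
      lift_precompose[OF B slot_linear(1) slot_linear(3) \<phi> r_closed inv]
      lift_precompose[OF B slot_linear(2) slot_linear(4) \<phi> r_closed inv]
      lift_precompose[OF B slot_linear(3) slot_linear(2) \<phi> R_closed invR])
  finally show ?thesis .
qed

section \<open>Axiom (1) for \<alpha>\<close>

lemma op_mult_pure:
  "\<lbrakk>a \<in> carrier HH; b \<in> carrier HH; c \<in> carrier HH; d \<in> carrier HH\<rbrakk> \<Longrightarrow>
    (a \<boxtimes> b) \<otimes>\<^bsub>E.TA\<^esub> (c \<boxtimes> d) = (a \<otimes>\<^bsub>HH\<^esub> c) \<boxtimes> (d \<otimes>\<^bsub>HH\<^esub> b)"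
  using E.mult_pure[of a b c d] by simp

text \<open>Slots 1 and 2 keep their multiplication while slots 3 and 4 become antihomomorphisms, as
  \<open>lift_op_inverse\<close> requires of its two maps.\<close>

lemma slot_op_homs:
  "slot1 \<in> algebra_homs K H E.TA" "slot2 \<in> algebra_homs K H E.TA"
  "slot3 \<in> algebra_homs K (op_algebra H) E.TA" "slot4 \<in> algebra_homs K (op_algebra H) E.TA"
proof -
  have *: "(\<lambda>x. x \<boxdot> \<one>\<^bsub>H\<^esub>) \<in> algebra_homs K (op_algebra H) (op_algebra HH)"
    "(\<lambda>x. \<one>\<^bsub>H\<^esub> \<boxdot> x) \<in> algebra_homs K (op_algebra H) (op_algebra HH)"
    using SQ.A2.pure_left_hom SQ.A2.pure_right_hom by (simp_all only: algebra_homs_op(1))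
  show "slot1 \<in> algebra_homs K H E.TA" "slot2 \<in> algebra_homs K H E.TA"
    using algebra_homs_compose[OF SQ.A2.pure_left_hom E.pure_left_hom]
      algebra_homs_compose[OF SQ.A2.pure_right_hom E.pure_left_hom]
    by (simp_all add: slot_defs[abs_def] tensor_algebra_simps(4))
  show "slot3 \<in> algebra_homs K (op_algebra H) E.TA" "slot4 \<in> algebra_homs K (op_algebra H) E.TA"
    using algebra_homs_compose[OF *(1) E.pure_right_hom] algebra_homs_compose[OF *(2) E.pure_right_hom]
    by (simp_all add: slot_defs[abs_def] tensor_algebra_simps(4))
qed

lemma slot_op_linear:
  "slot1 \<in> linear_maps K H E.TA" "slot2 \<in> linear_maps K H E.TA"
  "slot3 \<in> linear_maps K H E.TA" "slot4 \<in> linear_maps K H E.TA"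
  using slot_op_homs[THEN algebra_homs_linear] by simp_all

lemmas slot_op_linear' = slot_op_linear
  slot_op_linear[THEN linear_maps_compose[OF algebra_homs_linear[OF D_hom]]]
  slot_op_linear[THEN linear_maps_compose[OF algebra_homs_linear[OF U_hom]]]

lemma op_tensor_map:
  assumes \<phi>: "\<phi> \<in> algebra_homs K HH HH"
  shows "tensor_map K HH (op_algebra HH) \<phi> id \<in> add_hom H4 E.TA"
    and "tensor_map K HH (op_algebra HH) id \<phi> \<in> add_hom H4 E.TA"
    and "s \<in> carrier HH \<Longrightarrow> t \<in> carrier HH \<Longrightarrow> tensor_map K HH (op_algebra HH) \<phi> id (s \<boxtimes> t) = \<phi> s \<boxtimes> t"
    and "s \<in> carrier HH \<Longrightarrow> t \<in> carrier HH \<Longrightarrow> tensor_map K HH (op_algebra HH) id \<phi> (s \<boxtimes> t) = s \<boxtimes> \<phi> t"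
  using SQ2.A2.tensor_map_hom[OF E.algebra_product_axioms, of \<phi> id]
    SQ2.A2.tensor_map_hom[OF E.algebra_product_axioms, of id \<phi>] algebra_homs_linear[OF \<phi>]
  by (simp_all add: id_linear)

text \<open>The order of the factors is forced up to one choice. Name them 14, 13, 24, 32 by their
  legs: slot 1 puts 14 before 13, slot 2 puts 24 before 32, and the reversed slots 3 and 4 put 32
  before 13 and 24 before 14. The order 24, 32, 14, 13 satisfies all four.\<close>

lemma alpha_op:
  "tensor_map K HH (op_algebra HH) id UU (alpha_tensor K H r)
    = tensor_lift E.TA slot2 (\<lambda>x. slot4 (U x)) r \<otimes>\<^bsub>E.TA\<^esub> tensor_lift E.TA (\<lambda>x. slot3 (U x)) slot2 R
      \<otimes>\<^bsub>E.TA\<^esub> tensor_lift E.TA slot1 (\<lambda>x. slot4 (U x)) r \<otimes>\<^bsub>E.TA\<^esub> tensor_lift E.TA slot1 (\<lambda>x. slot3 (U x)) r"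
proof -
  note L = SQ.A2.tensor_lift_linear[OF SQ2.A2.TA.assoc_algebra_axioms]
    and L' = SQ.A2.tensor_lift_linear[OF E.TA.assoc_algebra_axioms]
  note UD = algebra_homsD[OF U_hom]
  note TM = op_tensor_map[OF UU_hom]
  let ?M = "\<lambda>s t u v. tensor_map K HH (op_algebra HH) id UU
      (tensor_lift H4 slot1 slot4 s \<otimes>\<^bsub>H4\<^esub> tensor_lift H4 slot1 slot3 t
        \<otimes>\<^bsub>H4\<^esub> tensor_lift H4 slot2 slot4 u \<otimes>\<^bsub>H4\<^esub> tensor_lift H4 slot3 slot2 v)"
    and ?M' = "\<lambda>s t u v. tensor_lift E.TA slot2 (\<lambda>x. slot4 (U x)) u
      \<otimes>\<^bsub>E.TA\<^esub> tensor_lift E.TA (\<lambda>x. slot3 (U x)) slot2 v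
      \<otimes>\<^bsub>E.TA\<^esub> tensor_lift E.TA slot1 (\<lambda>x. slot4 (U x)) s \<otimes>\<^bsub>E.TA\<^esub> tensor_lift E.TA slot1 (\<lambda>x. slot3 (U x)) t"
  show ?thesis
    unfolding alpha_factors
  proof (rule SQ.A2.quad_additive_eqI[where M = ?M and M' = ?M'])
    show "abelian_group E.TA" by (rule E.abelian_group_tensor)
    show "quad_additive HH E.TA ?M"
      by (intro quad_additive_compose[OF _ TM(2)] SQ2.A2.TA.alg.quad_additive_product L(1) slot_linear)
    show "quad_additive HH E.TA ?M'"
      by (intro E.TA.alg.quad_additive_product L'(1) slot_op_linear')
  qed (simp_all add: L(2) L'(2) slot_linear slot_op_linear',
      simp add: slot_defs SQ.A2.mult_pure SQ2.A2.mult_pure op_mult_pure TM UU_pure UD)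
qed

text \<open>The slot constraints are now 13 before 14, 32 before 24, 13 before 32 and 14 before 24.
  Of the two admissible orders, 13, 14, 32, 24 is the reverse of the one in \<open>alpha_op\<close>,
  so that the two products telescope.\<close>

lemma alpha_inverse_op:
  "tensor_map K HH (op_algebra HH) DD id (inv\<^bsub>H4\<^esub> (alpha_tensor K H r))
    = tensor_lift E.TA (\<lambda>x. slot1 (D x)) slot3 R \<otimes>\<^bsub>E.TA\<^esub> tensor_lift E.TA (\<lambda>x. slot1 (D x)) slot4 R
      \<otimes>\<^bsub>E.TA\<^esub> tensor_lift E.TA slot3 (\<lambda>x. slot2 (D x)) r \<otimes>\<^bsub>E.TA\<^esub> tensor_lift E.TA (\<lambda>x. slot2 (D x)) slot4 R"
proof -
  note L = SQ.A2.tensor_lift_linear[OF SQ2.A2.TA.assoc_algebra_axioms]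
    and L' = SQ.A2.tensor_lift_linear[OF E.TA.assoc_algebra_axioms]
  note DH = algebra_homsD[OF D_hom]
  note TM = op_tensor_map[OF DD_hom]
  let ?M = "\<lambda>s t u v. tensor_map K HH (op_algebra HH) DD id
      (tensor_lift H4 slot3 slot2 s \<otimes>\<^bsub>H4\<^esub> tensor_lift H4 slot2 slot4 t
        \<otimes>\<^bsub>H4\<^esub> tensor_lift H4 slot1 slot3 u \<otimes>\<^bsub>H4\<^esub> tensor_lift H4 slot1 slot4 v)"
    and ?M' = "\<lambda>s t u v. tensor_lift E.TA (\<lambda>x. slot1 (D x)) slot3 u
      \<otimes>\<^bsub>E.TA\<^esub> tensor_lift E.TA (\<lambda>x. slot1 (D x)) slot4 v
      \<otimes>\<^bsub>E.TA\<^esub> tensor_lift E.TA slot3 (\<lambda>x. slot2 (D x)) s \<otimes>\<^bsub>E.TA\<^esub> tensor_lift E.TA (\<lambda>x. slot2 (D x)) slot4 t"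
  show ?thesis
    unfolding alpha_inverse(2)
  proof (rule SQ.A2.quad_additive_eqI[where M = ?M and M' = ?M'])
    show "abelian_group E.TA" by (rule E.abelian_group_tensor)
    show "quad_additive HH E.TA ?M"
      by (intro quad_additive_compose[OF _ TM(1)] SQ2.A2.TA.alg.quad_additive_product L(1) slot_linear)
    show "quad_additive HH E.TA ?M'"
      by (intro E.TA.alg.quad_additive_product L'(1) slot_op_linear')
  qed (simp_all add: L(2) L'(2) slot_linear slot_op_linear',
      simp add: slot_defs SQ.A2.mult_pure SQ2.A2.mult_pure op_mult_pure TM DD_pure DH)
qed

text \<open>Factors with equal legs face each other. Three pairs cancel by
  \<open>lift_op_inverse\<close>; in the pair with legs 32 the first leg is the antihomomorphism and
  \<open>r\<close> and \<open>R\<close> have changed places, which calls for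
  \<open>lift_op_inverse'\<close>.\<close>

lemma alpha_op_inverse:
  "tensor_map K HH (op_algebra HH) DD id (inv\<^bsub>H4\<^esub> (alpha_tensor K H r))
    \<otimes>\<^bsub>E.TA\<^esub> tensor_map K HH (op_algebra HH) id UU (alpha_tensor K H r) = \<one>\<^bsub>E.TA\<^esub>"
  "tensor_map K HH (op_algebra HH) id UU (alpha_tensor K H r)
    \<otimes>\<^bsub>E.TA\<^esub> tensor_map K HH (op_algebra HH) DD id (inv\<^bsub>H4\<^esub> (alpha_tensor K H r)) = \<one>\<^bsub>E.TA\<^esub>"
proof -
  note B = E.TA.assoc_algebra_axioms
  note cl = add_homD(1)[OF SQ.A2.tensor_lift_linear(1)[OF B]]
  have comm: "commuting_maps E.TA (carrier H) (carrier H) slot1 slot3"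
    "commuting_maps E.TA (carrier H) (carrier H) slot1 slot4"
    "commuting_maps E.TA (carrier H) (carrier H) slot2 slot3"
    "commuting_maps E.TA (carrier H) (carrier H) slot2 slot4"
    by (auto simp: commuting_maps_def slot_defs op_mult_pure SQ.A2.mult_pure)
  note inv = lift_op_inverse[OF B slot_op_homs(1) slot_op_homs(3) comm(1)]
    lift_op_inverse[OF B slot_op_homs(1) slot_op_homs(4) comm(2)]
    lift_op_inverse'[OF B slot_op_homs(2) slot_op_homs(3) comm(3)]
    lift_op_inverse[OF B slot_op_homs(2) slot_op_homs(4) comm(4)]
  show "tensor_map K HH (op_algebra HH) DD id (inv\<^bsub>H4\<^esub> (alpha_tensor K H r))
    \<otimes>\<^bsub>E.TA\<^esub> tensor_map K HH (op_algebra HH) id UU (alpha_tensor K H r) = \<one>\<^bsub>E.TA\<^esub>"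
    unfolding alpha_op alpha_inverse_op
    by (rule E.TA.alg.telescope; (rule inv cl slot_op_linear' r_closed R_closed)+)
  show "tensor_map K HH (op_algebra HH) id UU (alpha_tensor K H r)
    \<otimes>\<^bsub>E.TA\<^esub> tensor_map K HH (op_algebra HH) DD id (inv\<^bsub>H4\<^esub> (alpha_tensor K H r)) = \<one>\<^bsub>E.TA\<^esub>"
    unfolding alpha_op alpha_inverse_op
    by (rule E.TA.alg.telescope; (rule inv cl slot_op_linear' r_closed R_closed)+)
qed

section \<open>Axiom (3) for \<alpha>\<close>

text \<open>Even strands lie above odd ones, and of two strands of equal parity the one listed first is the upper one;
  the crossing \<open>X i j\<close> carries the flipped inverse exactly if \<open>j\<close> is the upper strand.\<close>

lemma mixed_yang_baxter:
  fixes x :: "nat \<Rightarrow> 'b \<Rightarrow> 'x"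
  assumes B: "assoc_algebra K B"
    and x: "\<And>i. i < n \<Longrightarrow> x i \<in> algebra_homs K H B"
    and comm: "\<And>i j. i < n \<Longrightarrow> j < n \<Longrightarrow> i \<noteq> j \<Longrightarrow> commuting_maps B (carrier H) (carrier H) (x i) (x j)"
    and ijk: "i < n" "j < n" "k < n" "distinct [i, j, k]"
  defines "X \<equiv> \<lambda>i j. if odd i \<and> even j then tensor_lift B (x j) (x i) R else tensor_lift B (x i) (x j) r"
  shows "X i j \<otimes>\<^bsub>B\<^esub> X i k \<otimes>\<^bsub>B\<^esub> X j k = X j k \<otimes>\<^bsub>B\<^esub> X i k \<otimes>\<^bsub>B\<^esub> X i j"
proof -
  interpret B: assoc_algebra K B by fact
  define P where "P i j = tensor_lift B (x i) (x j) r" for i j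
  define N where "N i j = tensor_lift B (x i) (x j) R" for i j
  note cl = add_homD(1)[OF SQ.A2.tensor_lift_linear(1)[OF B x[THEN algebra_homs_linear] x[THEN algebra_homs_linear]]]
  have c [simp]: "P i j \<in> carrier B" "N i j \<in> carrier B" if "i < n" "j < n" for i j
    using that by (auto simp: P_def N_def intro!: cl)
  have PN [simp]: "P i j \<otimes>\<^bsub>B\<^esub> N i j = \<one>\<^bsub>B\<^esub>" "N i j \<otimes>\<^bsub>B\<^esub> P i j = \<one>\<^bsub>B\<^esub>"
    if "i < n" "j < n" "i \<noteq> j" for i j
    using that lift_inverse[OF B x x comm] by (simp_all add: P_def N_def)
  have yb: "P i j \<otimes>\<^bsub>B\<^esub> P i k \<otimes>\<^bsub>B\<^esub> P j k = P j k \<otimes>\<^bsub>B\<^esub> P i k \<otimes>\<^bsub>B\<^esub> P i j"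
    if "i < n" "j < n" "k < n" "distinct [i, j, k]" for i j k
    unfolding P_def by (rule yang_baxter[OF B]) (use that x comm in auto)
  note inv = B.alg.braid_inverse
  \<comment> \<open>Each of the four variants inverts an end factor of an earlier equation for a
    permuted triple: \<open>1\<close> and \<open>2\<close> contain one inverse crossing,
    \<open>3\<close> and \<open>4\<close> contain two.\<close>
  have 1: "N k j \<otimes>\<^bsub>B\<^esub> P i k \<otimes>\<^bsub>B\<^esub> P i j = P i j \<otimes>\<^bsub>B\<^esub> P i k \<otimes>\<^bsub>B\<^esub> N k j"
    if "i < n" "j < n" "k < n" "distinct [i, j, k]" for i j k
    using inv[OF yb[of i k j, symmetric]] that by auto
  have 2: "N j i \<otimes>\<^bsub>B\<^esub> P i k \<otimes>\<^bsub>B\<^esub> P j k = P j k \<otimes>\<^bsub>B\<^esub> P i k \<otimes>\<^bsub>B\<^esub> N j i"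
    if "i < n" "j < n" "k < n" "distinct [i, j, k]" for i j k
    using inv[OF yb[of j i k]] that by auto
  have 3: "N j i \<otimes>\<^bsub>B\<^esub> N k i \<otimes>\<^bsub>B\<^esub> P j k = P j k \<otimes>\<^bsub>B\<^esub> N k i \<otimes>\<^bsub>B\<^esub> N j i"
    if "i < n" "j < n" "k < n" "distinct [i, j, k]" for i j k
    using inv[OF 1[of j i k, symmetric]] that by auto
  have 4: "N k j \<otimes>\<^bsub>B\<^esub> N k i \<otimes>\<^bsub>B\<^esub> P i j = P i j \<otimes>\<^bsub>B\<^esub> N k i \<otimes>\<^bsub>B\<^esub> N k j"
    if "i < n" "j < n" "k < n" "distinct [i, j, k]" for i j k
    using inv[OF 2[of i k j, symmetric]] that by auto
  have X: "X i j = (if odd i \<and> even j then N j i else P i j)" for i j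
    by (simp add: X_def P_def N_def)
  \<comment> \<open>Parity leaves five sign patterns: no inverse crossing when no odd strand
    precedes an even one (\<open>yb\<close>), and otherwise odd-even-odd (\<open>2\<close>),
    odd-even-even (\<open>3\<close>), even-odd-even (\<open>1\<close>) and odd-odd-even
    (\<open>4\<close>). The other patterns would contradict the ordering of the strands by
    height.\<close>
  show ?thesis
    using ijk by (auto simp: X intro!: yb 2 3 1[symmetric] 4[symmetric])
qed

lemma alpha_yang_baxter:
  "leg12 K HH (alpha_tensor K H r) \<otimes>\<^bsub>SQ2.cube\<^esub> leg13 K HH (alpha_tensor K H r) \<otimes>\<^bsub>SQ2.cube\<^esub> leg23 K HH (alpha_tensor K H r)
   = leg23 K HH (alpha_tensor K H r) \<otimes>\<^bsub>SQ2.cube\<^esub> leg13 K HH (alpha_tensor K H r) \<otimes>\<^bsub>SQ2.cube\<^esub> leg12 K HH (alpha_tensor K H r)"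
proof -
  let ?B = "SQ2.cube"
  note B = SQ2.A3.TA.assoc_algebra_axioms
  define J where "J m = (if m = 0 then (\<lambda>s. triple_tensor K HH s \<one>\<^bsub>HH\<^esub> \<one>\<^bsub>HH\<^esub>)
    else if m = 1 then (\<lambda>s. triple_tensor K HH \<one>\<^bsub>HH\<^esub> s \<one>\<^bsub>HH\<^esub>)
    else (\<lambda>s. triple_tensor K HH \<one>\<^bsub>HH\<^esub> \<one>\<^bsub>HH\<^esub> s))" for m :: nat
  \<comment> \<open>\<open>x i\<close> embeds \<open>H\<close> as strand \<open>i\<close> of the
    sixfold tensor power, namely as factor \<open>i mod 2\<close> inside the copy
    \<open>i div 2\<close> of \<open>HH\<close>. Strands are counted from 0, so the odd strands of
    the overview are the even ones here.\<close>
  define x where "x i = (\<lambda>h. J (i div 2) (if even i then h \<boxdot> \<one>\<^bsub>H\<^esub> else \<one>\<^bsub>H\<^esub> \<boxdot> h))" for i :: nat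
  define X where "X i j = (if odd i \<and> even j then tensor_lift ?B (x j) (x i) R else tensor_lift ?B (x i) (x j) r)"
    for i j
  have J: "J m \<in> algebra_homs K HH ?B" for m
    using SQ2.triple_homs by (simp add: J_def)
  have J_comm: "commuting_maps ?B (carrier HH) (carrier HH) (J m) (J n)" if "m < 3" "n < 3" "m \<noteq> n" for m n
    using that SQ2.triple_commuting SQ2.triple_commuting[THEN commuting_maps_sym]
    by (auto simp: J_def)
  have x: "x i \<in> algebra_homs K H ?B" for i
    using algebra_homs_compose[OF SQ.A2.pure_left_hom J] algebra_homs_compose[OF SQ.A2.pure_right_hom J]
    by (cases "even i") (simp_all add: x_def)
  have x_comm: "commuting_maps ?B (carrier H) (carrier H) (x i) (x j)"
    if ij: "i < 6" "j < 6" "i \<noteq> j" for i j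
  \<comment> \<open>Two strands in one copy of \<open>HH\<close> commute already there, before
    \<open>J\<close> is applied; strands in different copies commute because the images of the
    embeddings \<open>J\<close> do.\<close>
  proof (cases "i div 2 = j div 2")
    case True
    then have "even i \<noteq> even j" using ij(3) by presburger
    then show ?thesis
      using True by (auto simp: commuting_maps_def x_def algebra_homsD(2)[OF J, symmetric] SQ.A2.mult_pure)
  next
    case False
    have "i div 2 < 3" "j div 2 < 3" using ij by auto
    from J_comm[OF this False] show ?thesis
      by (auto simp: commuting_maps_def x_def)
  qed
  note lin = x[THEN algebra_homs_linear]
  have X_cl: "X i j \<in> carrier ?B" for i j
    using add_homD(1)[OF SQ.A2.tensor_lift_linear(1)[OF B lin lin]] by (simp add: X_def)
  have lift_comm: "tensor_lift ?B (x i) (x j) s \<otimes>\<^bsub>?B\<^esub> tensor_lift ?B (x k) (x l) t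
      = tensor_lift ?B (x k) (x l) t \<otimes>\<^bsub>?B\<^esub> tensor_lift ?B (x i) (x j) s"
    if "i < 6" "j < 6" "k < 6" "l < 6" "distinct [i, j, k, l]" "s \<in> carrier HH" "t \<in> carrier HH" for i j k l s t
    using that
    by (intro SQ.A2.tensor_lift_lift_commute[OF B lin lin lin lin x_comm x_comm x_comm x_comm]) auto
  have X_comm: "X i j \<otimes>\<^bsub>?B\<^esub> X k l = X k l \<otimes>\<^bsub>?B\<^esub> X i j"
    if "i < 6" "j < 6" "k < 6" "l < 6" "distinct [i, j, k, l]" for i j k l
    using that by (simp add: X_def lift_comm)
  \<comment> \<open>Only the last factor has an odd first and an even second index, so it is the one
    that \<open>X\<close> reads as an inverse with swapped legs, in agreement with the last factor
    of \<alpha>.\<close>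
  have cab: "tensor_lift ?B (J m) (J n) (alpha_tensor K H r)
      = X (2*m) (2*n+1) \<otimes>\<^bsub>?B\<^esub> X (2*m) (2*n) \<otimes>\<^bsub>?B\<^esub> X (2*m+1) (2*n+1) \<otimes>\<^bsub>?B\<^esub> X (2*m+1) (2*n)"
    if "m < 3" "n < 3" "m \<noteq> n" for m n
  proof -
    note hom = SQ2.A2.tensor_lift_hom[OF B J J J_comm[OF that]]
    note lift = SQ2.A2.tensor_lift_linear(2)[OF B algebra_homs_linear[OF J] algebra_homs_linear[OF J]]
    have one: "J m (\<one>\<^bsub>H\<^esub> \<boxdot> \<one>\<^bsub>H\<^esub>) = \<one>\<^bsub>?B\<^esub>" for m
      using algebra_homsD(4)[OF J[of m]] by (simp add: tensor_algebra_simps(4)[of K H H])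
    have "tensor_lift ?B (J m) (J n) (alpha_tensor K H r)
      = tensor_lift ?B (x (2*m)) (x (2*n+1)) r \<otimes>\<^bsub>?B\<^esub> tensor_lift ?B (x (2*m)) (x (2*n)) r
        \<otimes>\<^bsub>?B\<^esub> tensor_lift ?B (x (2*m+1)) (x (2*n+1)) r \<otimes>\<^bsub>?B\<^esub> tensor_lift ?B (x (2*n)) (x (2*m+1)) R"
      by (rule alpha_image[OF B hom])
        (simp_all add: slot_defs lift one x_def algebra_homsD(1)[OF J])
    then show ?thesis by (simp add: X_def)
  qed
  have alpha: "alpha_tensor K H r \<in> carrier H4" using alpha_inverse(1) by auto
  have legs: "leg12 K HH (alpha_tensor K H r) = X 0 3 \<otimes>\<^bsub>?B\<^esub> X 0 2 \<otimes>\<^bsub>?B\<^esub> X 1 3 \<otimes>\<^bsub>?B\<^esub> X 1 2"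
    "leg13 K HH (alpha_tensor K H r) = X 0 5 \<otimes>\<^bsub>?B\<^esub> X 0 4 \<otimes>\<^bsub>?B\<^esub> X 1 5 \<otimes>\<^bsub>?B\<^esub> X 1 4"
    "leg23 K HH (alpha_tensor K H r) = X 2 5 \<otimes>\<^bsub>?B\<^esub> X 2 4 \<otimes>\<^bsub>?B\<^esub> X 3 5 \<otimes>\<^bsub>?B\<^esub> X 3 4"
    using cab[of 0 1] cab[of 0 2] cab[of 1 2] SQ2.leg_eq_lift[OF alpha] by (simp_all add: J_def)
  show ?thesis
    unfolding legs
  proof (rule SQ2.A3.TA.alg.cabling_yang_baxter)
    show "X i j \<otimes>\<^bsub>?B\<^esub> X i k \<otimes>\<^bsub>?B\<^esub> X j k = X j k \<otimes>\<^bsub>?B\<^esub> X i k \<otimes>\<^bsub>?B\<^esub> X i j"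
      if "i < 6" "j < 6" "k < 6" "distinct [i, j, k]" for i j k
      unfolding X_def by (rule mixed_yang_baxter[OF B _ _ that]) (auto intro: x x_comm)
  qed (use X_cl X_comm in auto)
qed

theorem tensor_square_oriented:
  "oriented_quantum_algebra K HH (alpha_tensor K H r) DD UU"
proof (intro oriented_quantum_algebra.intro oriented_quantum_algebra_axioms.intro)
  show "assoc_algebra K HH" by (rule SQ.A2.TA.assoc_algebra_axioms)
  show "alpha_tensor K H r \<in> Units H4" by (rule alpha_inverse(1))
  show "DD \<in> algebra_auto K HH" "UU \<in> algebra_auto K HH"
    by (rule SQ.tensor_map_auto D_auto U_auto)+
  show "DD (UU t) = UU (DD t)" if t: "t \<in> carrier HH" for t
    by (rule SQ.A2.tensor_eqI[OF SQ.A2.abelian_group_tensor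
        add_hom_compose[OF UU_hom[THEN algebra_homs_add_hom] DD_hom[THEN algebra_homs_add_hom]]
        add_hom_compose[OF DD_hom[THEN algebra_homs_add_hom] UU_hom[THEN algebra_homs_add_hom]] _ t])
      (simp add: DD_pure UU_pure D_U_commute algebra_homsD(1)[OF D_hom] algebra_homsD(1)[OF U_hom])
  show "tensor_map K HH HH DD DD (alpha_tensor K H r) = alpha_tensor K H r"
    by (rule alpha_invariant[OF D_hom qa2(1)])
  show "tensor_map K HH HH UU UU (alpha_tensor K H r) = alpha_tensor K H r"
    by (rule alpha_invariant[OF U_hom qa2(2)])
qed (simp_all only: alpha_op_inverse alpha_yang_baxter tensor_cube_def)

end

theorem theorem3p7:
  fixes K :: "('k, 'm) ring_scheme" and H :: "('k, 'a, 'n) module_scheme"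
    and p :: "('a \<times> 'a \<Rightarrow>\<^sub>0 int) set" and D U :: "'a \<Rightarrow> 'a"
  assumes "oriented_quantum_algebra K H p D U"
  shows "oriented_quantum_algebra K (tensor_algebra K H H) (alpha_tensor K H p)
           (tensor_map K H H D D) (tensor_map K H H U U)"
  using assms by (rule oriented_quantum_algebra.tensor_square_oriented)

end
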